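(* Let $m$ and $n$ be positive integers. Then, modulo $\Phi_n(q)^2$, \[ T_1(mn,(m-1)n,q)\equiv 2m-nm(2m-1)(1-q^n)+(-1)^n\bigl((1+(-1)^n)(m-1)+1\bigr)\bigl(mq^n-nm(m-1)(1-q^n)+2m(\mathcal{B}_n(q)-1)\bigr). \]
   Context: For integers $n,k$ the $q$-binomial coefficient is ${n\brack k}={n\brack k}_q=\frac{(1-q^n)(1-q^{n-1})\cdots(1-q^{n-k+1})}{(1-q)(1-q^2)\cdots(1-q^k)}$ if $0\le k\le n$, and $0$ otherwise; ${n\brack k}_{q^2}$ denotes the same with $q$ replaced by $q^2$. The $q$-trinomial coefficient of Andrews and Baxter is \[ T_1(N,M,q)=\sum_{k=0}^{N}(-q)^k{N\brack k}_{q^2}{2N-2k\brack N-M-k}. \] $\Phi_n(q)$ is the $n$th cyclotomic polynomial. For rational functions $A(q),B(q)$ and a polynomial $P(q)\in\mathbb{Z}[q]$, $A(q)\equiv B(q)\pmod{P(q)}$ means that $A(q)-B(q)$, written as a quotient $A_1(q)/A_2(q)$, has numerator divisible by $P(q)$ and denominator coprime to $P(q)$. Define, for a positive integer $n$, \[ \mathcal{B}_n(q)=\begin{cases}(-1)^r(1+q^{2r})q^{r(3r-5)/2}, & n=3r,\\ (-1)^rq^{r(3r+1)/2}, & n=3r+1,\\ (-1)^{r+1}q^{(r-1)(3r+2)/2}, & n=3r+2.\end{cases} \] *)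

theory Defs
  imports "HOL-Computational_Algebra.Computational_Algebra"
begin

definition qbinom :: "'a::field \<Rightarrow> int \<Rightarrow> int \<Rightarrow> 'a" where
  "qbinom q n k =
     (if 0 \<le> k \<and> k \<le> n
      then (\<Prod>i=1..nat k. 1 - q ^ nat (n - int i + 1)) / (\<Prod>i=1..nat k. 1 - q ^ i)
      else 0)"

definition T1 :: "nat \<Rightarrow> int \<Rightarrow> 'a::field \<Rightarrow> 'a" where
  "T1 N M q =
     (\<Sum>k=0..N. (- q) ^ k * qbinom (q\<^sup>2) (int N) (int k)
                  * qbinom q (2 * int N - 2 * int k) (int N - M - int k))"

(* The halved exponents are always integers, but may be negative (-1 for n = 2 and n = 3). *)
definition Bn :: "nat \<Rightarrow> 'a::field \<Rightarrow> 'a" where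
  "Bn n q =
     (let r = n div 3; s = int r in
      if n mod 3 = 0 then (-1) ^ r * (1 + q ^ (2 * r)) * q powi (s * (3 * s - 5) div 2)
      else if n mod 3 = 1 then (-1) ^ r * q powi (s * (3 * s + 1) div 2)
      else (-1) ^ (r + 1) * q powi ((s - 1) * (3 * s + 2) div 2))"

definition primitive_roots :: "nat \<Rightarrow> complex set" where
  "primitive_roots n = {z. z ^ n = 1 \<and> (\<forall>k. 0 < k \<and> k < n \<longrightarrow> z ^ k \<noteq> 1)}"

definition cyclotomic :: "nat \<Rightarrow> int poly" where
  "cyclotomic n = (THE p. map_poly of_int p = (\<Prod>z\<in>primitive_roots n. [:- z, 1:]))"

definition qvar :: "int poly fract" where
  "qvar = to_fract [:0, 1:]"

definition ratfun_cong :: "int poly fract \<Rightarrow> int poly fract \<Rightarrow> int poly \<Rightarrow> bool" where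
  "ratfun_cong A B P \<longleftrightarrow>
     (\<exists>A1 A2. A2 \<noteq> 0 \<and> A - B = Fract A1 A2 \<and> P dvd A1 \<and> coprime A2 P)"

lemma primitive_roots_disjoint:
  assumes "d > 0" "e > 0" "d \<noteq> e"
  shows "primitive_roots d \<inter> primitive_roots e = {}"
proof (rule equals0I)
  fix z assume "z \<in> primitive_roots d \<inter> primitive_roots e"
  hence "z ^ d = 1" "z ^ e = 1" "\<not> e < d" "\<not> d < e"
    using assms(1,2) by (auto simp: primitive_roots_def)
  thus False using assms(3) by simp
qed

lemma roots_of_unity_decomp:
  assumes "n > 0"
  shows "{z::complex. z ^ n = 1} = (\<Union>d\<in>{d. d dvd n}. primitive_roots d)"
proof (intro equalityI subsetI)
  fix z :: complex assume z: "z \<in> {z. z ^ n = 1}"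
  define d where "d = (LEAST k. 0 < k \<and> z ^ k = 1)"
  have d: "0 < d \<and> z ^ d = 1"
    unfolding d_def by (rule LeastI[of _ n]) (use z assms in auto)
  have least: "z ^ k \<noteq> 1" if "0 < k" "k < d" for k
    using not_less_Least[of k "\<lambda>k. 0 < k \<and> z ^ k = 1"] that by (auto simp: d_def)
  have "z ^ n = z ^ (d * (n div d) + n mod d)" by simp
  also have "\<dots> = z ^ (n mod d)" using d by (simp only: power_add power_mult) simp
  finally have "z ^ (n mod d) = 1" using z by simp
  hence "n mod d = 0" using least[of "n mod d"] d by auto
  thus "z \<in> (\<Union>d\<in>{d. d dvd n}. primitive_roots d)"
    using d least by (auto simp: primitive_roots_def dvd_eq_mod_eq_0)
next
  fix z assume "z \<in> (\<Union>d\<in>{d. d dvd n}. primitive_roots d)"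
  then obtain d k where "n = d * k" "z ^ d = 1" by (auto simp: primitive_roots_def)
  thus "z \<in> {z. z ^ n = 1}" by (simp add: power_mult)
qed

lemma finite_primitive_roots: "n > 0 \<Longrightarrow> finite (primitive_roots n)"
  by (rule finite_subset[of _ "{z. z ^ n = 1}"]) (auto simp: primitive_roots_def finite_roots_unity)

lemma prod_primitive_roots:
  assumes "n > 0"
  shows "(\<Prod>d | d dvd n. \<Prod>z\<in>primitive_roots d. [:- z, 1:]) = monom (1::complex) n - 1"
proof -
  let ?p = "monom (1::complex) n - 1"
  have pos: "d > 0" if "d dvd n" for d using that assms by (rule dvd_pos_nat[rotated])
  have poly: "poly ?p z = z ^ n - 1" for z by (simp add: poly_monom)
  have deg: "degree ?p = n"
    using degree_add_eq_left[of "-1" "monom (1::complex) n"] assms by (simp add: degree_monom_eq)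
  have lead: "lead_coeff ?p = 1" using assms by (simp add: deg)
  have "rsquarefree ?p"
    unfolding rsquarefree_roots
  proof (intro allI notI, elim conjE)
    fix a assume "poly ?p a = 0" "poly (pderiv ?p) a = 0"
    thus False using assms
      by (cases "a = 0") (auto simp: poly pderiv_diff pderiv_monom poly_monom zero_power)
  qed
  from complex_poly_decompose_rsquarefree[OF this]
  have "?p = (\<Prod>z | poly ?p z = 0. [:- z, 1:])"
    unfolding lead smult_1_left by (rule sym)
  also have "{z. poly ?p z = 0} = {z. z ^ n = 1}" unfolding poly by simp
  also have "(\<Prod>z | z ^ n = 1. [:- z, 1:]) = (\<Prod>d | d dvd n. \<Prod>z\<in>primitive_roots d. [:- z, 1:])"
    unfolding roots_of_unity_decomp[OF assms]
  proof (rule prod.UNION_disjoint)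
    show "\<forall>d\<in>{d. d dvd n}. finite (primitive_roots d)"
      by (auto intro: finite_primitive_roots pos)
    show "\<forall>d\<in>{d. d dvd n}. \<forall>e\<in>{d. d dvd n}. d \<noteq> e \<longrightarrow> primitive_roots d \<inter> primitive_roots e = {}"
      by (intro ballI impI primitive_roots_disjoint) (auto intro: pos)
  qed (use assms in simp)
  finally show ?thesis by (rule sym)
qed

lemma cyclotomic_exists:
  assumes "n > 0"
  shows "\<exists>p :: int poly. lead_coeff p = 1 \<and> map_poly of_int p = (\<Prod>z\<in>primitive_roots n. [:- z, 1:])"
  using assms
proof (induction n rule: less_induct)
  case (less n)
  let ?C = "\<lambda>d. \<Prod>z\<in>primitive_roots d. [:- z, 1:]"
  let ?D = "{d. d dvd n \<and> d \<noteq> n}"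
  have D: "{d. d dvd n} = insert n ?D" "finite ?D" using less.prems by auto
  have "\<exists>p :: int poly. lead_coeff p = 1 \<and> map_poly of_int p = ?C d" if "d \<in> ?D" for d
    using less.IH[of d] that less.prems dvd_imp_le[of d n] dvd_pos_nat[of n d] by force
  then obtain f :: "nat \<Rightarrow> int poly"
    where f: "\<And>d. d \<in> ?D \<Longrightarrow> lead_coeff (f d) = 1 \<and> map_poly of_int (f d) = ?C d" by metis
  define g where "g = (\<Prod>d\<in>?D. f d)"
  have g1: "lead_coeff g = 1" unfolding g_def lead_coeff_prod using f by simp
  have map_mult: "map_poly of_int (p * q) = (map_poly of_int p * map_poly of_int q :: complex poly)"
    for p q :: "int poly" by (rule poly_eqI) (simp add: coeff_map_poly coeff_mult)
  have map_prod: "map_poly of_int (prod h A) = (\<Prod>d\<in>A. map_poly of_int (h d) :: complex poly)"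
    for h :: "nat \<Rightarrow> int poly" and A
    by (induction A rule: infinite_finite_induct) (auto simp: map_mult)
  have gC: "map_poly of_int g = (\<Prod>d\<in>?D. ?C d)" unfolding g_def map_prod using f by simp
  obtain s r where sr: "pseudo_divmod (monom 1 n - 1) g = (s, r)" by fastforce
  have g0: "g \<noteq> 0" using g1 by auto
  from pseudo_divmod[OF g0 sr] g1
  have eq: "monom 1 n - 1 = g * s + r" and r: "r = 0 \<or> degree r < degree g" by auto
  let ?i = "map_poly of_int :: int poly \<Rightarrow> complex poly"
  have deg: "degree (?i p) = degree p" for p by (simp add: degree_map_poly)
  have "?i (monom 1 n - 1) = monom 1 n - 1"
    by (rule poly_eqI) (simp add: coeff_map_poly)
  also have "\<dots> = ?C n * ?i g"
    unfolding prod_primitive_roots[OF less.prems, symmetric] D(1) gC using D(2) by simp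
  also have "?i (monom 1 n - 1) = ?i g * ?i s + ?i r"
    unfolding eq map_mult[symmetric] by (rule poly_eqI) (simp add: coeff_map_poly)
  finally have e: "?i r = ?i g * (?C n - ?i s)" by (simp add: algebra_simps)
  have ig0: "?i g \<noteq> 0" using gC finite_primitive_roots
    by (metis g0 g1 coeff_map_poly of_int_1 of_int_0 zero_neq_one coeff_0)
  have "?C n - ?i s = 0"
  proof (rule ccontr)
    assume nz: "?C n - ?i s \<noteq> 0"
    hence "degree (?i r) = degree g + degree (?C n - ?i s)"
      using e degree_mult_eq[OF ig0 nz] deg by simp
    moreover have "r \<noteq> 0" using e nz ig0 by auto
    ultimately show False using r deg by simp
  qed
  hence s: "?i s = ?C n" by simp
  have "lead_coeff (?C n) = 1" by (simp add: lead_coeff_prod)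
  hence "of_int (lead_coeff s) = (1::complex)" unfolding s[symmetric] deg by (simp add: coeff_map_poly)
  hence "lead_coeff s = 1" by simp
  thus ?case using s by blast
qed

lemma map_poly_cyclotomic:
  assumes "n > 0"
  shows "map_poly of_int (cyclotomic n) = (\<Prod>z\<in>primitive_roots n. [:- z, 1:])"
proof -
  obtain p :: "int poly" where p: "map_poly of_int p = (\<Prod>z\<in>primitive_roots n. [:- z, 1:])"
    using cyclotomic_exists[OF assms] by blast
  have uniq: "q = p"
    if "map_poly of_int q = (\<Prod>z\<in>primitive_roots n. [:- z, 1:])" for q :: "int poly"
    using that unfolding p[symmetric] by (simp add: poly_eq_iff coeff_map_poly)
  show ?thesis unfolding cyclotomic_def by (rule theI[of _ p]) (fact p, rule uniq)
qed

end

(* Write q^n = 1 - e; e is divisible by Phi_n(q), so all quantities matter only to first order in e.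
   The summands k = 0 and k = n of T_1(mn, (m-1)n, q) are q-binomial coefficients of multiples of n
   and are expanded directly.  With k = n - j, the remaining summands with j > n/2 are divisible by
   e^2, and those with j <= n/2 are a common factor times
     (-1)^j q^(j(j-3)/2) (1-q^n)/(1-q^(n-j)) [n-j, j],
   where for even n the extra factor 2m - 1 appears because q^2 has order n/2 only.
   Summed over 0 <= j <= n/2, these terms give exactly B_n(q) = a_n - a_(n-2)/q, where
   a_n = sum_j (-1)^j q^(j choose 2) [n-j, j] satisfies a_n = -q^(n-2) a_(n-3). *)

theory Submission
  imports Defs
begin

section \<open>Powers\<close>

lemma Suc_choose_2: "Suc j choose 2 = (j choose 2) + j"
  by (simp add: numeral_2_eq_2)

lemma double_choose_2: "2 * (k choose 2) = k * (k - 1)"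
  by (cases k) (simp_all add: choose_two)

lemma of_nat_choose_2: "2 * of_nat (k choose 2) = (of_nat k * (of_nat k - 1) :: 'a::comm_ring_1)"
  by (induction k) (simp_all add: Suc_choose_2 binomial_eq_0 algebra_simps)

lemma power_uminus_mult:
  fixes x y :: "'a::comm_ring_1"
  shows "(- (x * y)) ^ k = (- x) ^ k * y ^ k"
  by (simp flip: power_mult_distrib)

lemma prod_uminus_inverse_powers:
  fixes p :: "'a::field"
  shows "(\<Prod>i=1..k. - 1 / p ^ (b + i)) = (-1) ^ k / p ^ (b * k + (Suc k choose 2))"
  by (induction k) (simp_all add: Suc_choose_2 power_add binomial_eq_0 field_simps)

definition infinite_order :: "'a::monoid_mult \<Rightarrow> bool" where
  "infinite_order q \<longleftrightarrow> (\<forall>i>0. q ^ i \<noteq> 1)"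

lemma infinite_order_power:
  assumes "infinite_order q" "k > 0"
  shows "infinite_order (q ^ k)"
  using assms by (simp add: infinite_order_def flip: power_mult)

lemma infinite_orderD: "infinite_order q \<Longrightarrow> i > 0 \<Longrightarrow> q ^ i \<noteq> 1"
  by (simp add: infinite_order_def)

lemma one_minus_power_neq_0:
  fixes q :: "'a::field"
  assumes "infinite_order q" "i > 0"
  shows "1 - q ^ i \<noteq> 0"
  using infinite_orderD[OF assms] by simp

section \<open>The \<open>q\<close>-binomial coefficients\<close>

(* For k > n the numerator contains the factor 1 - q^0 = 0. *)
definition qchoose :: "'a::field \<Rightarrow> nat \<Rightarrow> nat \<Rightarrow> 'a" where
  "qchoose q n k = (\<Prod>i=1..k. (1 - q ^ (n + 1 - i)) / (1 - q ^ i))"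

lemma qchoose_eq_0:
  assumes "n < k"
  shows "qchoose q n k = 0"
proof -
  have "n + 1 \<in> {1..k}" using assms by simp
  moreover have "(1 - q ^ (n + 1 - (n + 1))) / (1 - q ^ (n + 1)) = 0" by simp
  ultimately show ?thesis unfolding qchoose_def by (intro prod_zero) blast+
qed

lemma qbinom_conv_qchoose: "qbinom q (int n) (int k) = qchoose q n k"
proof (cases "k \<le> n")
  case True
  have "nat (int n - int i + 1) = n + 1 - i" if "i \<in> {1..k}" for i
    using that True by auto
  hence "(\<Prod>i=1..k. 1 - q ^ nat (int n - int i + 1)) = (\<Prod>i=1..k. 1 - q ^ (n + 1 - i))"
    by (intro prod.cong) simp_all
  thus ?thesis using True by (simp add: qbinom_def qchoose_def prod_dividef)
qed (simp add: qbinom_def qchoose_eq_0)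

lemma qchoose_0_right [simp]: "qchoose q n 0 = 1"
  by (simp add: qchoose_def)

lemma qchoose_add_left: "qchoose q (m + k) k = (\<Prod>i=1..k. (1 - q ^ (m + i)) / (1 - q ^ i))"
proof -
  have "(\<Prod>i=1..k. 1 - q ^ (m + k + 1 - i)) = (\<Prod>i=1..k. 1 - q ^ (m + i))"
    by (rule prod.reindex_bij_witness[of _ "\<lambda>i. k + 1 - i" "\<lambda>i. k + 1 - i"])
       (auto intro!: arg_cong[where f = "\<lambda>x. q ^ x"])
  thus ?thesis by (simp add: qchoose_def prod_dividef)
qed

lemma qchoose_self:
  assumes "\<And>i. i \<in> {1..n} \<Longrightarrow> 1 - q ^ i \<noteq> 0"
  shows "qchoose q n n = 1"
proof -
  have "qchoose q n n = (\<Prod>i=1..n. (1 - q ^ (0 + i)) / (1 - q ^ i))"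
    using qchoose_add_left[of q 0 n] by simp
  also have "\<dots> = (\<Prod>i=1..n. 1)" by (intro prod.cong refl) (use assms in simp)
  finally show ?thesis by simp
qed

lemma qchoose_Suc_right: "qchoose q n (Suc k) = (1 - q ^ (n - k)) / (1 - q ^ Suc k) * qchoose q n k"
  by (simp add: qchoose_def)

lemma qchoose_Suc_Suc:
  "qchoose q (Suc n) (Suc k) = (1 - q ^ Suc n) / (1 - q ^ Suc k) * qchoose q n k"
proof -
  have "(\<Prod>i=1..Suc k. 1 - q ^ (Suc n + 1 - i))
      = (1 - q ^ Suc n) * (\<Prod>i=Suc 1..Suc k. 1 - q ^ (Suc n + 1 - i))"
    by (subst prod.atLeast_Suc_atMost) simp_all
  also have "(\<Prod>i=Suc 1..Suc k. 1 - q ^ (Suc n + 1 - i)) = (\<Prod>i=1..k. 1 - q ^ (n + 1 - i))"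
    unfolding prod.shift_bounds_cl_Suc_ivl by simp
  finally show ?thesis by (simp add: qchoose_def prod_dividef)
qed

lemma qchoose_absorption:
  assumes "0 < k" "k \<le> n"
  shows "qchoose q n k = (1 - q ^ n) / (1 - q ^ k) * qchoose q (n - 1) (k - 1)"
  using qchoose_Suc_Suc[of q "n - 1" "k - 1"] assms by simp

lemma qchoose_pascal:
  assumes "q ^ Suc k \<noteq> 1"
  shows "qchoose q (Suc n) (Suc k) = qchoose q n (Suc k) + q ^ (n - k) * qchoose q n k"
    and "qchoose q (Suc n) (Suc k) = q ^ Suc k * qchoose q n (Suc k) + qchoose q n k"
proof -
  define x y where "x = q ^ Suc k" and "y = q ^ (n - k)"
  have "x \<noteq> 1" using assms by (simp add: x_def)
  have top: "qchoose q (Suc n) (Suc k) = (1 - y * x) / (1 - x) * qchoose q n k"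
  proof (cases "k \<le> n")
    case True
    hence "q ^ Suc n = y * x" by (simp add: x_def y_def flip: power_add power_Suc)
    thus ?thesis by (simp only: qchoose_Suc_Suc x_def)
  qed (simp add: qchoose_eq_0)
  have right: "qchoose q n (Suc k) = (1 - y) / (1 - x) * qchoose q n k"
    unfolding qchoose_Suc_right x_def y_def ..
  have "(1 - y * x) / (1 - x) = (1 - y) / (1 - x) + y"
    using \<open>x \<noteq> 1\<close> by (simp add: divide_simps) (simp add: algebra_simps)
  thus "qchoose q (Suc n) (Suc k) = qchoose q n (Suc k) + q ^ (n - k) * qchoose q n k"
    unfolding top right y_def[symmetric] by (simp add: distrib_right)
  have "(1 - y * x) / (1 - x) = x * ((1 - y) / (1 - x)) + 1"
    using \<open>x \<noteq> 1\<close> by (simp add: divide_simps) (simp add: algebra_simps)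
  thus "qchoose q (Suc n) (Suc k) = q ^ Suc k * qchoose q n (Suc k) + qchoose q n k"
    unfolding top right x_def[symmetric] by (simp add: algebra_simps)
qed

lemma qchoose_conv_prod_quotient:
  fixes q :: "'a::field"
  assumes "infinite_order q"
  shows "qchoose q (m + k) k =
    (\<Prod>i=1..m+k. 1 - q ^ i) / ((\<Prod>i=1..k. 1 - q ^ i) * (\<Prod>i=1..m. 1 - q ^ i))"
proof (induction k)
  case 0
  show ?case using one_minus_power_neq_0[OF assms] by simp
next
  case (Suc k)
  show ?case unfolding add_Suc_right qchoose_Suc_Suc Suc.IH by (simp add: mult_ac)
qed

lemma qchoose_neq_0:
  assumes "infinite_order q" "k \<le> n"
  shows "qchoose q n k \<noteq> 0"
  using qchoose_conv_prod_quotient[OF assms(1), of "n - k" k] assms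
  by (simp add: infinite_orderD)

lemma qchoose_mult:
  fixes q :: "'a::field"
  assumes q: "infinite_order q" and "j \<le> k" "k \<le> n"
  shows "qchoose q n k * qchoose q k j = qchoose q n j * qchoose q (n - j) (k - j)"
proof -
  have quotient: "qchoose q b a =
      (\<Prod>i=1..b. 1 - q ^ i) / ((\<Prod>i=1..a. 1 - q ^ i) * (\<Prod>i=1..b-a. 1 - q ^ i))"
    if "a \<le> b" for a b
    using qchoose_conv_prod_quotient[OF q, of "b - a" a] that by simp
  have nonzero: "(\<Prod>i=1..a. 1 - q ^ i) \<noteq> 0" for a
    using one_minus_power_neq_0[OF q] by simp
  have "n - j - (k - j) = n - k" using assms by simp
  thus ?thesis using assms nonzero[of j] nonzero[of k] nonzero[of "n - j"]
    by (simp add: quotient del: prod_zero_iff)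
qed

lemma qchoose_multiple:
  fixes p :: "'a::field"
  assumes "\<And>i. 0 < i \<Longrightarrow> i \<le> h \<Longrightarrow> 1 - p ^ i \<noteq> 0" and "h > 0"
  shows "qchoose p (Suc c * h) h =
    (\<Prod>i=1..<h. 1 + (1 - (p ^ h) ^ c) * (p ^ i / (1 - p ^ i))) * (\<Sum>i<Suc c. (p ^ h) ^ i)"
proof -
  have "{1..h} = insert h {1..<h}" using assms(2) by auto
  hence "qchoose p (Suc c * h) h =
      (1 - p ^ (c * h + h)) / (1 - p ^ h) * (\<Prod>i=1..<h. (1 - p ^ (c * h + i)) / (1 - p ^ i))"
    using qchoose_add_left[of p "c * h" h] by (simp add: add.commute)
  also have "(1 - p ^ (c * h + h)) / (1 - p ^ h) = (\<Sum>i<Suc c. (p ^ h) ^ i)"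
  proof -
    have "p ^ (c * h + h) = (p ^ h) ^ Suc c" by (simp add: power_add mult.commute flip: power_mult)
    moreover have "p ^ h \<noteq> 1" using assms by force
    ultimately show ?thesis using one_diff_power_eq[of "p ^ h" "Suc c"] by simp
  qed
  also have "(\<Prod>i=1..<h. (1 - p ^ (c * h + i)) / (1 - p ^ i)) =
      (\<Prod>i=1..<h. 1 + (1 - (p ^ h) ^ c) * (p ^ i / (1 - p ^ i)))"
  proof (rule prod.cong)
    fix i assume i: "i \<in> {1..<h}"
    have "p ^ (c * h + i) = (p ^ h) ^ c * p ^ i"
      by (simp add: power_add mult.commute flip: power_mult)
    moreover have "1 - p ^ i \<noteq> 0" using assms(1) i by simp
    ultimately show "(1 - p ^ (c * h + i)) / (1 - p ^ i)
        = 1 + (1 - (p ^ h) ^ c) * (p ^ i / (1 - p ^ i))"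
      by (simp add: field_simps)
  qed simp
  finally show ?thesis by (simp only: mult.commute)
qed

section \<open>Alternating \<open>q\<close>-Fibonacci sums\<close>

definition qfib :: "'a::field \<Rightarrow> 'a \<Rightarrow> nat \<Rightarrow> 'a" where
  "qfib q z n = (\<Sum>j\<le>n. (- z) ^ j * q ^ (j choose 2) * qchoose q (n - j) j)"

lemma qfib_Suc:
  "qfib q z (Suc n)
    = 1 + (\<Sum>j\<le>n. (- z) ^ Suc j * q ^ ((j choose 2) + j) * qchoose q (n - j) (Suc j))"
  unfolding qfib_def sum.atMost_Suc_shift by (simp add: Suc_choose_2 binomial_eq_0)

lemma qfib_Suc_Suc:
  "qfib q z (Suc (Suc n))
    = 1 + (\<Sum>j\<le>n. (- z) ^ Suc j * q ^ ((j choose 2) + j) * qchoose q (Suc (n - j)) (Suc j))"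
  unfolding qfib_Suc sum.atMost_Suc by (simp add: qchoose_eq_0 Suc_diff_le)

lemma qfib_rec:
  fixes q z :: "'a::field"
  assumes "infinite_order q"
  shows "qfib q z (Suc (Suc n)) = qfib q (z * q) (Suc n) - z * qfib q (z * q) n"
proof -
  have "(- z) ^ Suc j * q ^ ((j choose 2) + j) * qchoose q (Suc (n - j)) (Suc j) =
      (- (z * q)) ^ Suc j * q ^ ((j choose 2) + j) * qchoose q (n - j) (Suc j)
      - z * ((- (z * q)) ^ j * q ^ (j choose 2) * qchoose q (n - j) j)" for j
  proof -
    have "q ^ Suc j \<noteq> 1" using assms by (rule infinite_orderD) simp
    hence "qchoose q (Suc (n - j)) (Suc j)
        = q ^ Suc j * qchoose q (n - j) (Suc j) + qchoose q (n - j) j"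
      by (rule qchoose_pascal(2))
    thus ?thesis unfolding power_uminus_mult by (simp add: power_add algebra_simps)
  qed
  thus ?thesis unfolding qfib_Suc_Suc qfib_Suc[of q "z * q"] qfib_def[of q "z * q" n]
    by (simp only: sum_subtractf sum_distrib_left) simp
qed

lemma qfib_shift_rec:
  fixes q z :: "'a::field"
  assumes "infinite_order q"
  shows "qfib q (z * q) (Suc (Suc n)) = qfib q (z * q) (Suc n) - z * q ^ Suc n * qfib q z n"
proof -
  have "(- (z * q)) ^ Suc j * q ^ ((j choose 2) + j) * qchoose q (Suc (n - j)) (Suc j) =
      (- (z * q)) ^ Suc j * q ^ ((j choose 2) + j) * qchoose q (n - j) (Suc j)
      - z * q ^ Suc n * ((- z) ^ j * q ^ (j choose 2) * qchoose q (n - j) j)" for j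
  proof (cases "2 * j \<le> n")
    case True
    have "q ^ Suc j \<noteq> 1" using assms by (rule infinite_orderD) simp
    hence "qchoose q (Suc (n - j)) (Suc j)
        = qchoose q (n - j) (Suc j) + q ^ (n - j - j) * qchoose q (n - j) j"
      by (rule qchoose_pascal(1))
    moreover have "q ^ Suc n = q ^ (n - j - j) * q ^ j * q ^ Suc j"
      unfolding power_add[symmetric] using True by (intro arg_cong[where f = "\<lambda>x. q ^ x"]) simp
    ultimately show ?thesis unfolding power_uminus_mult
      by (simp only:) (simp add: power_add algebra_simps)
  qed (simp add: qchoose_eq_0)
  thus ?thesis unfolding qfib_Suc_Suc qfib_Suc[of q "z * q"] qfib_def[of q z n]
    by (simp only: sum_subtractf sum_distrib_left) simp
qed

lemma qfib_add_3:
  assumes "infinite_order q"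
  shows "qfib q 1 (n + 3) = - (q ^ (n + 1) * qfib q 1 n)"
  using qfib_rec[OF assms, of 1 "Suc n"] qfib_shift_rec[OF assms, of 1 n]
  by (simp add: numeral_3_eq_3)

lemma qfib_closed_form:
  fixes q :: "'a::field"
  assumes q: "infinite_order q"
  shows "qfib q 1 (3 * r) = (-1) ^ r * q ^ (3 * (r choose 2) + r)"
    and "qfib q 1 (3 * r + 1) = (-1) ^ r * q ^ (3 * (r choose 2) + 2 * r)"
    and "qfib q 1 (3 * r + 2) = 0"
proof (induction r)
  case 0
  have "qchoose q 1 1 = 1"
    by (rule qchoose_self) (simp add: one_minus_power_neq_0[OF q, of 1, simplified])
  thus "qfib q 1 (3 * 0) = (-1) ^ 0 * q ^ (3 * (0 choose 2) + 0)"
    "qfib q 1 (3 * 0 + 1) = (-1) ^ 0 * q ^ (3 * (0 choose 2) + 2 * 0)"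
    "qfib q 1 (3 * 0 + 2) = 0"
    by (simp_all add: qfib_def qchoose_eq_0 binomial_eq_0 numeral_2_eq_2)
next
  case (Suc r)
  have index: "3 * Suc r = 3 * r + 3" "3 * Suc r + c = (3 * r + c) + 3" for c by simp_all
  show "qfib q 1 (3 * Suc r) = (-1) ^ Suc r * q ^ (3 * (Suc r choose 2) + Suc r)"
    unfolding index(1) qfib_add_3[OF q] Suc Suc_choose_2
    by (simp add: algebra_simps flip: power_add)
  show "qfib q 1 (3 * Suc r + 1) = (-1) ^ Suc r * q ^ (3 * (Suc r choose 2) + 2 * Suc r)"
    unfolding index(2) qfib_add_3[OF q] Suc Suc_choose_2 by (simp add: algebra_simps flip: power_add)
  show "qfib q 1 (3 * Suc r + 2) = 0"
    unfolding index(2) qfib_add_3[OF q] Suc by simp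
qed

lemma Bn_closed_form:
  fixes q :: "'a::field"
  assumes "q \<noteq> 0"
  shows "Bn (3 * r + 2) q = (-1) ^ Suc r * q ^ (3 * (r choose 2) + r) / q"
    and "Bn (3 * Suc r) q
      = (-1) ^ Suc r * (1 + q ^ (2 * Suc r)) * q ^ (3 * (r choose 2) + 2 * r) / q"
    and "Bn (3 * r + 1) q = (-1) ^ r * q ^ (3 * (r choose 2) + 2 * r)"
proof -
  have powi_pred: "q powi (int k - 1) = q ^ k / q" for k
    using assms by (simp add: power_int_diff)
  note double = of_nat_choose_2[where 'a = int, of r]
  have div_mod: "(3 * r + 2) div 3 = r" "(3 * r + 2) mod 3 = 2" by presburger+
  have "2 * ((int r - 1) * (3 * int r + 2) div 2) = 2 * (int (3 * (r choose 2) + r) - 1)"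
    using double by (simp add: algebra_simps)
  hence exponent: "(int r - 1) * (3 * int r + 2) div 2 = int (3 * (r choose 2) + r) - 1" by simp
  show "Bn (3 * r + 2) q = (-1) ^ Suc r * q ^ (3 * (r choose 2) + r) / q"
    unfolding Bn_def Let_def div_mod exponent powi_pred by simp
  have div_mod: "(3 * Suc r) div 3 = Suc r" "(3 * Suc r) mod 3 = 0" by presburger+
  have "2 * (int (Suc r) * (3 * int (Suc r) - 5) div 2) = 2 * (int (3 * (r choose 2) + 2 * r) - 1)"
    using double by (simp add: algebra_simps)
  hence exponent: "int (Suc r) * (3 * int (Suc r) - 5) div 2 = int (3 * (r choose 2) + 2 * r) - 1"
    by simp
  show "Bn (3 * Suc r) q
      = (-1) ^ Suc r * (1 + q ^ (2 * Suc r)) * q ^ (3 * (r choose 2) + 2 * r) / q"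
    unfolding Bn_def Let_def div_mod exponent powi_pred by simp
  have div_mod: "(3 * r + 1) div 3 = r" "(3 * r + 1) mod 3 = 1" by presburger+
  have "2 * (int r * (3 * int r + 1) div 2) = 2 * int (3 * (r choose 2) + 2 * r)"
    using double by (simp add: algebra_simps)
  hence exponent: "int r * (3 * int r + 1) div 2 = int (3 * (r choose 2) + 2 * r)" by simp
  show "Bn (3 * r + 1) q = (-1) ^ r * q ^ (3 * (r choose 2) + 2 * r)"
    unfolding Bn_def Let_def div_mod exponent power_int_of_nat by simp
qed

lemma Bn_conv_qfib:
  fixes q :: "'a::field"
  assumes q: "infinite_order q" and "q \<noteq> 0"
  shows "Bn (n + 2) q = qfib q 1 (n + 2) - qfib q 1 n / q"
proof -
  define r where "r = n div 3"
  note closed_forms = Bn_closed_form[OF assms(2)] qfib_closed_form[OF q]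
  have "n mod 3 = 0 \<or> n mod 3 = 1 \<or> n mod 3 = 2" by linarith
  then consider "n = 3 * r" | "n = 3 * r + 1" | "n = 3 * r + 2"
    unfolding r_def by (metis add_0_right mult_div_mod_eq)
  thus ?thesis
  proof cases
    case 1
    show ?thesis unfolding 1 closed_forms by simp
  next
    case 2
    have index: "3 * r + 1 + 2 = 3 * Suc r" by simp
    have "q ^ (3 * (Suc r choose 2) + Suc r) = q * q ^ (2 * r) * q ^ (3 * (r choose 2) + 2 * r)"
      by (simp add: Suc_choose_2 algebra_simps flip: power_add power_Suc)
    thus ?thesis unfolding 2 index closed_forms using assms(2) by (simp add: field_simps)
  next
    case 3
    have index: "3 * r + 2 + 2 = 3 * Suc r + 1" by simp
    show ?thesis unfolding 3 index closed_forms by simp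
  qed
qed

(* The j-th summand of the q-Lucas polynomial, in which q-absorption has replaced
   (1 - q^n) / (1 - q^(n-j)) [n-j, j] by (1 - q^n) / (1 - q^j) [n-j-1, j-1]. *)
definition qlucas_term :: "'a::field \<Rightarrow> nat \<Rightarrow> nat \<Rightarrow> 'a" where
  "qlucas_term q n j =
     (-1) ^ j * q ^ (j choose 2) / q ^ j * ((1 - q ^ n) / (1 - q ^ j)) * qchoose q (n - j - 1) (j - 1)"

lemma qlucas_term_Suc:
  fixes q :: "'a::field"
  assumes "infinite_order q" "q \<noteq> 0" "j \<le> m"
  shows "qlucas_term q (m + 2) (Suc j) =
    (- 1) ^ Suc j * q ^ ((j choose 2) + j) * qchoose q (Suc (m - j)) (Suc j)
    - (- 1) ^ j * q ^ (j choose 2) * qchoose q (m - j) j / q"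
proof -
  define x y c where "x = q ^ Suc j" and "y = q ^ Suc (m - j)" and "c = q ^ (j choose 2) / q"
  define s where "s = (1 - y) / (1 - x)"
  have "x \<noteq> 1" unfolding x_def using assms(1) by (rule infinite_orderD) simp
  have split: "(1 - y * x) / (1 - x) = x * s + 1"
    using \<open>x \<noteq> 1\<close> by (simp add: s_def divide_simps) (simp add: algebra_simps)
  have power: "q ^ ((j choose 2) + j) = c * x" "q ^ ((j choose 2) + j) / x = c"
    using assms(2) by (simp_all add: x_def c_def power_add)
  have "q ^ (m + 2) = y * x" using assms(3) by (simp add: x_def y_def flip: power_add power_Suc)
  hence "qlucas_term q (m + 2) (Suc j) =
      (-1) ^ Suc j * (q ^ ((j choose 2) + j) / x) * ((1 - y * x) / (1 - x)) * qchoose q (m - j) j"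
    unfolding qlucas_term_def x_def Suc_choose_2 by simp
  also have "\<dots> = (-1) ^ Suc j * (c * x) * (s * qchoose q (m - j) j)
      - (-1) ^ j * c * qchoose q (m - j) j"
    unfolding split power(2) by (simp add: algebra_simps)
  also have "(-1) ^ j * c * qchoose q (m - j) j
      = (-1) ^ j * q ^ (j choose 2) * qchoose q (m - j) j / q"
    by (simp add: c_def)
  finally show ?thesis unfolding qchoose_Suc_Suc power s_def x_def y_def .
qed

lemma qlucas_term_half:
  assumes "infinite_order q"
  shows "qlucas_term q (2 * h) h =
    (1 - q ^ (2 * h)) * ((-1) ^ h * q ^ (h choose 2) / q ^ h / (1 - q ^ h))"
proof -
  have "qchoose q (h - 1) (h - 1) = 1"
    by (intro qchoose_self one_minus_power_neq_0 assms) simp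
  moreover have "2 * h - h - 1 = h - 1" by simp
  ultimately show ?thesis by (simp add: qlucas_term_def)
qed

lemma Bn_conv_qlucas_sum:
  fixes q :: "'a::field"
  assumes q: "infinite_order q" "q \<noteq> 0" and "n > 0"
  shows "Bn n q = 1 + (\<Sum>j=1..<n. qlucas_term q n j)"
proof (cases "n = 1")
  case True
  thus ?thesis by (simp add: Bn_def)
next
  case False
  then obtain m where n_eq: "n = m + 2"
    using assms(3) by (metis add.commute add_2_eq_Suc' gr0_implies_Suc One_nat_def not_gr0)
  have "(\<Sum>j=1..<n. qlucas_term q n j) = (\<Sum>j\<le>m. qlucas_term q (m + 2) (Suc j))"
    unfolding n_eq by (rule sum.reindex_bij_witness[of _ Suc "\<lambda>j. j - 1"]) auto
  also have "\<dots> = (\<Sum>j\<le>m. (- 1) ^ Suc j * q ^ ((j choose 2) + j) * qchoose q (Suc (m - j)) (Suc j)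
      - (- 1) ^ j * q ^ (j choose 2) * qchoose q (m - j) j / q)"
    using qlucas_term_Suc[OF q] by (intro sum.cong) auto
  also have "\<dots> = qfib q 1 n - 1 - qfib q 1 m / q"
    unfolding n_eq add_2_eq_Suc' qfib_Suc_Suc qfib_def[of q 1 m]
    by (simp only: sum_subtractf sum_divide_distrib) simp
  finally show ?thesis unfolding n_eq Bn_conv_qfib[OF q] by simp
qed

section \<open>Coprimality to cyclotomic polynomials\<close>

abbreviation complex_poly :: "int poly \<Rightarrow> complex poly" where
  "complex_poly \<equiv> map_poly of_int"

lemma complex_poly_mult: "complex_poly (a * b) = complex_poly a * complex_poly b"
  by (rule poly_eqI) (simp add: coeff_map_poly coeff_mult)

lemma complex_poly_prod: "complex_poly (\<Prod>d\<in>A. h d) = (\<Prod>d\<in>A. complex_poly (h d))"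
  by (induction A rule: infinite_finite_induct) (simp_all add: complex_poly_mult)

lemma complex_poly_eq_iff: "complex_poly a = complex_poly b \<longleftrightarrow> a = b"
  by (simp add: poly_eq_iff coeff_map_poly)

lemma degree_complex_poly: "degree (complex_poly a) = degree a"
  by (simp add: degree_map_poly)

lemma lead_coeff_cyclotomic:
  assumes "n > 0"
  shows "lead_coeff (cyclotomic n) = 1"
proof -
  have "of_int (lead_coeff (cyclotomic n)) = lead_coeff (complex_poly (cyclotomic n))"
    by (simp add: degree_complex_poly coeff_map_poly)
  also have "\<dots> = 1"
    unfolding map_poly_cyclotomic[OF assms] by (simp add: lead_coeff_prod)
  finally show ?thesis by simp
qed

lemma poly_cyclotomic_eq_0_iff:
  assumes "n > 0"
  shows "poly (complex_poly (cyclotomic n)) z = 0 \<longleftrightarrow> z \<in> primitive_roots n"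
  using finite_primitive_roots[OF assms]
  by (auto simp: map_poly_cyclotomic[OF assms] poly_prod)

lemma prod_cyclotomic:
  assumes "n > 0"
  shows "(\<Prod>d | d dvd n. cyclotomic d) = monom 1 n - 1"
proof -
  have "complex_poly (\<Prod>d | d dvd n. cyclotomic d) = (\<Prod>d | d dvd n. \<Prod>z\<in>primitive_roots d. [:- z, 1:])"
    unfolding complex_poly_prod
    by (rule prod.cong) (use assms in \<open>auto intro!: map_poly_cyclotomic dest: dvd_pos_nat[rotated]\<close>)
  also have "\<dots> = complex_poly (monom 1 n - 1)"
    unfolding prod_primitive_roots[OF assms] by (rule poly_eqI) (simp add: coeff_map_poly)
  finally show ?thesis by (simp only: complex_poly_eq_iff)
qed

lemma cyclotomic_dvd_monom_minus_1:
  assumes "n > 0"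
  shows "cyclotomic n dvd monom 1 n - 1"
  unfolding prod_cyclotomic[OF assms, symmetric] using assms by (intro dvd_prodI) auto

lemma coprime_cyclotomicI:
  assumes "n > 0" and nonzero: "\<And>z. z \<in> primitive_roots n \<Longrightarrow> poly (complex_poly b) z \<noteq> 0"
  shows "coprime b (cyclotomic n)"
proof (rule coprimeI)
  fix d assume "d dvd b" "d dvd cyclotomic n"
  then obtain x y where factors: "b = d * x" "cyclotomic n = d * y" by (auto elim!: dvdE)
  have no_root: "poly (complex_poly d) z \<noteq> 0" for z
    using nonzero[of z] poly_cyclotomic_eq_0_iff[OF assms(1), of z]
    by (auto simp: factors complex_poly_mult)
  have "degree d = 0"
  proof (rule ccontr)
    assume "degree d \<noteq> 0"
    hence "\<not> constant (poly (complex_poly d))"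
      by (simp add: constant_degree degree_complex_poly)
    thus False using fundamental_theorem_of_algebra no_root by blast
  qed
  then obtain c where d_eq: "d = [:c:]" by (rule degree_eq_zeroE)
  have "lead_coeff d * lead_coeff y = 1"
    unfolding lead_coeff_mult[symmetric] factors(2)[symmetric]
    by (rule lead_coeff_cyclotomic[OF assms(1)])
  hence "c dvd 1" unfolding d_eq by (metis dvd_triv_left lead_coeff_pCons(2) pCons_0_0)
  thus "is_unit d" unfolding d_eq by (simp add: is_unit_const_poly_iff)
qed

lemma primitive_root_power_eq_1_iff:
  assumes "n > 0" "z \<in> primitive_roots n"
  shows "z ^ i = 1 \<longleftrightarrow> n dvd i"
proof -
  have "z ^ n = 1" and minimal: "\<And>k. 0 < k \<Longrightarrow> k < n \<Longrightarrow> z ^ k \<noteq> 1"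
    using assms(2) by (auto simp: primitive_roots_def)
  have "z ^ i = z ^ (n * (i div n) + i mod n)" by simp
  also have "\<dots> = z ^ (i mod n)"
    using \<open>z ^ n = 1\<close> by (simp only: power_add power_mult) simp
  finally have "z ^ i = 1 \<longleftrightarrow> i mod n = 0"
    using minimal[of "i mod n"] assms(1) by (cases "i mod n = 0") auto
  thus ?thesis by (simp add: dvd_eq_mod_eq_0)
qed

lemma not_dvd_double:
  fixes l n :: nat
  assumes "0 < l" "l < n" "2 * l \<noteq> n"
  shows "\<not> n dvd 2 * l"
proof
  assume "n dvd 2 * l"
  then obtain c where c_eq: "2 * l = n * c" by (elim dvdE)
  have "\<not> n * 2 \<le> n * c" using c_eq assms by linarith
  hence "c < 2" by (metis mult_le_mono2 not_le)
  thus False using c_eq assms by (cases c) auto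
qed

section \<open>Localization at an element of a ring with greatest common divisors\<close>

locale localization =
  fixes \<pi> :: "'a::{idom, ring_gcd}"
begin

(* The powers of the ideal generated by \<pi> in the subring \<I> 0 of fractions whose denominator is
   coprime to \<pi>. *)
definition ideal_pow :: "nat \<Rightarrow> 'a fract set" ("\<I>") where
  "\<I> e = {Fract (\<pi> ^ e * a) b | a b. b \<noteq> 0 \<and> coprime b \<pi>}"

definition units :: "'a fract set" ("\<U>") where
  "\<U> = {f. f \<noteq> 0 \<and> f \<in> \<I> 0 \<and> inverse f \<in> \<I> 0}"

definition cong_mod :: "'a fract \<Rightarrow> nat \<Rightarrow> 'a fract \<Rightarrow> bool" ("(_ \<cong>\<^bsub>_\<^esub>/ _)" [51, 0, 51] 50) where
  "f \<cong>\<^bsub>e\<^esub> g \<longleftrightarrow> f \<in> \<I> 0 \<and> g \<in> \<I> 0 \<and> f - g \<in> \<I> e"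

lemma ideal_powI: "b \<noteq> 0 \<Longrightarrow> coprime b \<pi> \<Longrightarrow> Fract (\<pi> ^ e * a) b \<in> \<I> e"
  by (auto simp: ideal_pow_def)

lemma ideal_powE:
  assumes "f \<in> \<I> e"
  obtains a b where "b \<noteq> 0" "coprime b \<pi>" "f = Fract (\<pi> ^ e * a) b"
  using assms by (auto simp: ideal_pow_def)

lemma ideal_pow_0I: "b \<noteq> 0 \<Longrightarrow> coprime b \<pi> \<Longrightarrow> Fract a b \<in> \<I> 0"
  using ideal_powI[of b 0 a] by simp

lemma integral_to_fract: "to_fract a \<in> \<I> 0"
  unfolding to_fract_def by (rule ideal_pow_0I) simp_all

lemma ideal_pow_mult:
  assumes "f \<in> \<I> d" "g \<in> \<I> e"
  shows "f * g \<in> \<I> (d + e)"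
proof -
  obtain a b a' b' where "b \<noteq> 0" "coprime b \<pi>" "f = Fract (\<pi> ^ d * a) b"
    "b' \<noteq> 0" "coprime b' \<pi>" "g = Fract (\<pi> ^ e * a') b'"
    using assms by (meson ideal_powE)
  moreover from this have "f * g = Fract (\<pi> ^ (d + e) * (a * a')) (b * b')"
    by (simp add: power_add mult_ac)
  ultimately show ?thesis by (simp add: ideal_powI)
qed

lemma ideal_pow_add:
  assumes "f \<in> \<I> e" "g \<in> \<I> e"
  shows "f + g \<in> \<I> e"
proof -
  obtain a b a' b' where "b \<noteq> 0" "coprime b \<pi>" "f = Fract (\<pi> ^ e * a) b"
    "b' \<noteq> 0" "coprime b' \<pi>" "g = Fract (\<pi> ^ e * a') b'"
    using assms by (meson ideal_powE)
  moreover from this have "f + g = Fract (\<pi> ^ e * (a * b' + a' * b)) (b * b')"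
    by (simp add: distrib_left mult_ac)
  ultimately show ?thesis by (simp add: ideal_powI)
qed

lemma ideal_pow_antimono:
  assumes "f \<in> \<I> e" "d \<le> e"
  shows "f \<in> \<I> d"
proof -
  obtain a b where denominator: "b \<noteq> 0" "coprime b \<pi>" and f_eq: "f = Fract (\<pi> ^ e * a) b"
    using assms(1) by (rule ideal_powE)
  have "\<pi> ^ e * a = \<pi> ^ d * (\<pi> ^ (e - d) * a)"
    using assms(2) by (simp flip: power_add mult.assoc)
  thus ?thesis unfolding f_eq by (simp only: ideal_powI[OF denominator])
qed

lemma ideal_pow_imp_integral: "f \<in> \<I> e \<Longrightarrow> f \<in> \<I> 0"
  by (erule ideal_pow_antimono) simp

lemma ideal_pow_mult_right: "f \<in> \<I> e \<Longrightarrow> g \<in> \<I> 0 \<Longrightarrow> f * g \<in> \<I> e"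
  using ideal_pow_mult[of f e g 0] by simp

lemma ideal_pow_mult_left: "f \<in> \<I> 0 \<Longrightarrow> g \<in> \<I> e \<Longrightarrow> f * g \<in> \<I> e"
  using ideal_pow_mult[of f 0 g e] by simp

lemmas ideal_pow_2_mult = ideal_pow_mult[of _ 1 _ 1, unfolded one_add_one]

lemma ideal_pow_0: "0 \<in> \<I> e"
  using ideal_powI[of 1 e 0] by (simp add: Zero_fract_def)

lemma integral_1: "1 \<in> \<I> 0"
  using integral_to_fract[of 1] by simp

lemma integral_of_nat: "of_nat k \<in> \<I> 0"
  unfolding of_nat_fract by (rule ideal_pow_0I) simp_all

lemma integral_numeral: "numeral k \<in> \<I> 0"
  using integral_of_nat[of "numeral k"] by simp

lemma ideal_pow_uminus: "f \<in> \<I> e \<Longrightarrow> - f \<in> \<I> e"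
  using ideal_pow_mult_left[of "to_fract (- 1)" f e] integral_to_fract[of "- 1"] by simp

lemma ideal_pow_diff: "f \<in> \<I> e \<Longrightarrow> g \<in> \<I> e \<Longrightarrow> f - g \<in> \<I> e"
  using ideal_pow_add[of f e "- g"] ideal_pow_uminus by simp

lemma ideal_pow_sum: "(\<And>x. x \<in> A \<Longrightarrow> f x \<in> \<I> e) \<Longrightarrow> (\<Sum>x\<in>A. f x) \<in> \<I> e"
  by (induction A rule: infinite_finite_induct) (auto intro: ideal_pow_0 ideal_pow_add)

lemma integral_mult: "f \<in> \<I> 0 \<Longrightarrow> g \<in> \<I> 0 \<Longrightarrow> f * g \<in> \<I> 0"
  using ideal_pow_mult[of f 0 g 0] by simp

lemma integral_power: "f \<in> \<I> 0 \<Longrightarrow> f ^ k \<in> \<I> 0"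
  by (induction k) (auto intro: integral_1 integral_mult)

lemma integral_prod: "(\<And>x. x \<in> A \<Longrightarrow> f x \<in> \<I> 0) \<Longrightarrow> (\<Prod>x\<in>A. f x) \<in> \<I> 0"
  by (induction A rule: infinite_finite_induct) (auto intro: integral_1 integral_mult)

lemma units_imp_integral: "f \<in> \<U> \<Longrightarrow> f \<in> \<I> 0"
  and units_imp_neq_0: "f \<in> \<U> \<Longrightarrow> f \<noteq> 0"
  by (auto simp: units_def)

lemma ideal_pow_divide: "f \<in> \<I> e \<Longrightarrow> g \<in> \<U> \<Longrightarrow> f / g \<in> \<I> e"
  unfolding divide_inverse units_def by (auto intro: ideal_pow_mult_right)

lemma units_mult: "f \<in> \<U> \<Longrightarrow> g \<in> \<U> \<Longrightarrow> f * g \<in> \<U>"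
  by (auto simp: units_def intro: integral_mult)

lemma units_power: "f \<in> \<U> \<Longrightarrow> f ^ k \<in> \<U>"
  by (auto simp: units_def power_inverse[symmetric] intro: integral_power)

lemma units_to_fract: "a \<noteq> 0 \<Longrightarrow> coprime a \<pi> \<Longrightarrow> to_fract a \<in> \<U>"
  unfolding units_def by (auto simp: integral_to_fract) (auto simp: to_fract_def ideal_pow_0I)

lemmas integral_intros = ideal_pow_add ideal_pow_diff ideal_pow_uminus ideal_pow_sum ideal_pow_0
  integral_1 integral_of_nat integral_numeral integral_mult integral_power integral_prod
  ideal_pow_divide

(* The ideal \<I> 1 is contained in the Jacobson radical of \<I> 0. *)
lemma units_perturb:
  assumes "f \<noteq> 0" "f - g \<in> \<I> 1" "g \<in> \<U>"
  shows "f \<in> \<U>"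
proof -
  have "g \<noteq> 0" using assms(3) by (rule units_imp_neq_0)
  have "(f - g) / g \<in> \<I> 1" using assms(2,3) by (rule ideal_pow_divide)
  then obtain a b where denominator: "b \<noteq> 0" "coprime b \<pi>" and "(f - g) / g = Fract (\<pi> ^ 1 * a) b"
    by (rule ideal_powE)
  moreover have "f / g = 1 + (f - g) / g" using \<open>g \<noteq> 0\<close> by (simp add: field_simps)
  ultimately have quotient: "f / g = Fract (b + \<pi> * a) b" by (simp add: One_fract_def)
  have "b + \<pi> * a \<noteq> 0" using quotient assms(1) \<open>g \<noteq> 0\<close> by (auto simp: fract_collapse)
  moreover have "coprime (b + \<pi> * a) \<pi>"
    using denominator(2) gcd_add_mult[of \<pi> a b]
    by (simp add: coprime_iff_gcd_eq_1 gcd.commute add.commute mult.commute)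
  ultimately have "f / g \<in> \<I> 0" "inverse (f / g) \<in> \<I> 0"
    unfolding quotient using denominator by (simp_all add: ideal_pow_0I)
  hence "f / g \<in> \<U>" using assms(1) \<open>g \<noteq> 0\<close> by (simp add: units_def)
  hence "f / g * g \<in> \<U>" using assms(3) by (rule units_mult)
  thus ?thesis using \<open>g \<noteq> 0\<close> by simp
qed

lemma cong_modI: "f - g \<in> \<I> e \<Longrightarrow> g \<in> \<I> 0 \<Longrightarrow> f \<cong>\<^bsub>e\<^esub> g"
  unfolding cong_mod_def
  using ideal_pow_add[of "f - g" 0 g] ideal_pow_imp_integral[of "f - g"] by simp

lemma cong_mod_squareI:
  assumes "d \<in> \<I> 1" "x \<in> \<I> 0" "g \<in> \<I> 0" "f - g = d * (d * x)"
  shows "f \<cong>\<^bsub>2\<^esub> g"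
proof (rule cong_modI)
  show "f - g \<in> \<I> 2"
    unfolding assms(4) by (intro ideal_pow_2_mult ideal_pow_mult_right assms)
qed (rule assms)

lemma cong_mod_imp_integral: "f \<cong>\<^bsub>e\<^esub> g \<Longrightarrow> f \<in> \<I> 0"
  by (simp add: cong_mod_def)

lemma cong_mod_refl: "f \<in> \<I> 0 \<Longrightarrow> f \<cong>\<^bsub>e\<^esub> f"
  by (simp add: cong_mod_def ideal_pow_0)

lemma cong_mod_sym: "f \<cong>\<^bsub>e\<^esub> g \<Longrightarrow> g \<cong>\<^bsub>e\<^esub> f"
  unfolding cong_mod_def using ideal_pow_uminus[of "f - g"] by simp

lemma cong_mod_trans [trans]: "f \<cong>\<^bsub>e\<^esub> g \<Longrightarrow> g \<cong>\<^bsub>e\<^esub> h \<Longrightarrow> f \<cong>\<^bsub>e\<^esub> h"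
  unfolding cong_mod_def using ideal_pow_add[of "f - g" e "g - h"] by simp

lemma cong_mod_antimono: "f \<cong>\<^bsub>e\<^esub> g \<Longrightarrow> d \<le> e \<Longrightarrow> f \<cong>\<^bsub>d\<^esub> g"
  unfolding cong_mod_def by (auto intro: ideal_pow_antimono)

lemma cong_mod_0_iff: "f \<cong>\<^bsub>e\<^esub> 0 \<longleftrightarrow> f \<in> \<I> e"
  unfolding cong_mod_def using ideal_pow_0 ideal_pow_imp_integral by auto

lemma cong_mod_add:
  assumes "f \<cong>\<^bsub>e\<^esub> g" "f' \<cong>\<^bsub>e\<^esub> g'"
  shows "f + f' \<cong>\<^bsub>e\<^esub> g + g'"
proof -
  have "f + f' - (g + g') = (f - g) + (f' - g')" by simp
  thus ?thesis using assms unfolding cong_mod_def by (simp only: ideal_pow_add)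
qed

lemma cong_mod_diff:
  assumes "f \<cong>\<^bsub>e\<^esub> g" "f' \<cong>\<^bsub>e\<^esub> g'"
  shows "f - f' \<cong>\<^bsub>e\<^esub> g - g'"
proof -
  have "f - f' - (g - g') = (f - g) - (f' - g')" by simp
  thus ?thesis using assms unfolding cong_mod_def by (simp only: ideal_pow_diff)
qed

lemma cong_mod_mult:
  assumes "f \<cong>\<^bsub>e\<^esub> g" "f' \<cong>\<^bsub>e\<^esub> g'"
  shows "f * f' \<cong>\<^bsub>e\<^esub> g * g'"
proof -
  have "f * f' - g * g' = (f - g) * f' + g * (f' - g')" by (simp add: algebra_simps)
  thus ?thesis using assms unfolding cong_mod_def
    by (auto intro: ideal_pow_add ideal_pow_mult_left ideal_pow_mult_right integral_mult)
qed

lemma cong_mod_mult_ideal_pow: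
  assumes "h \<in> \<I> d" "f \<cong>\<^bsub>e\<^esub> g"
  shows "h * f \<cong>\<^bsub>d + e\<^esub> h * g"
  using assms ideal_pow_mult[of h d "f - g" e] ideal_pow_imp_integral[OF assms(1)]
  unfolding cong_mod_def by (simp add: integral_mult right_diff_distrib)

lemmas cong_mod_2_mult = cong_mod_mult_ideal_pow[of _ 1 _ 1, unfolded one_add_one]

lemma cong_mod_divide:
  assumes "f \<cong>\<^bsub>e\<^esub> g" "f' \<cong>\<^bsub>e\<^esub> g'" "f' \<in> \<U>" "g' \<in> \<U>"
  shows "f / f' \<cong>\<^bsub>e\<^esub> g / g'"
proof -
  have "inverse f' - inverse g' = (g' - f') / (f' * g')"
    using assms(3,4) by (simp add: units_def field_simps)
  hence "inverse f' \<cong>\<^bsub>e\<^esub> inverse g'"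
    using assms cong_mod_sym[OF assms(2)] unfolding cong_mod_def
    by (auto intro: ideal_pow_divide units_mult) (auto simp: units_def)
  thus ?thesis unfolding divide_inverse using assms(1) by (intro cong_mod_mult)
qed

lemma cong_mod_divide_right: "f \<cong>\<^bsub>e\<^esub> g \<Longrightarrow> h \<in> \<U> \<Longrightarrow> f / h \<cong>\<^bsub>e\<^esub> g / h"
  by (intro cong_mod_divide cong_mod_refl units_imp_integral)

lemma cong_mod_power: "f \<cong>\<^bsub>e\<^esub> g \<Longrightarrow> f ^ k \<cong>\<^bsub>e\<^esub> g ^ k"
  by (induction k) (auto intro: cong_mod_mult cong_mod_refl integral_1)

lemma cong_mod_sum:
  "(\<And>x. x \<in> A \<Longrightarrow> f x \<cong>\<^bsub>e\<^esub> g x) \<Longrightarrow> (\<Sum>x\<in>A. f x) \<cong>\<^bsub>e\<^esub> (\<Sum>x\<in>A. g x)"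
  by (induction A rule: infinite_finite_induct) (auto intro: cong_mod_add cong_mod_refl ideal_pow_0)

lemma cong_mod_prod:
  "(\<And>x. x \<in> A \<Longrightarrow> f x \<cong>\<^bsub>e\<^esub> g x) \<Longrightarrow> (\<Prod>x\<in>A. f x) \<cong>\<^bsub>e\<^esub> (\<Prod>x\<in>A. g x)"
  by (induction A rule: infinite_finite_induct) (auto intro: cong_mod_mult cong_mod_refl integral_1)

lemma cong_mod_2_mult_right:
  assumes "d \<in> \<I> 1" "f \<cong>\<^bsub>2\<^esub> d * x" "x \<in> \<I> 0" "y \<cong>\<^bsub>1\<^esub> y'"
  shows "f * y \<cong>\<^bsub>2\<^esub> d * (x * y')"
proof -
  have "f * y \<cong>\<^bsub>2\<^esub> d * x * y"
    by (intro cong_mod_mult cong_mod_refl assms cong_mod_imp_integral[OF assms(4)])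
  also have "\<dots> = d * (x * y)" by (rule mult.assoc)
  also have "\<dots> \<cong>\<^bsub>2\<^esub> d * (x * y')"
    by (intro cong_mod_2_mult cong_mod_mult cong_mod_refl assms)
  finally show ?thesis .
qed

lemma integral_if_one_minus:
  assumes "1 - P \<in> \<I> e"
  shows "P \<in> \<I> 0"
  using ideal_pow_diff[OF integral_1 ideal_pow_imp_integral[OF assms]] by simp

lemma one_minus_power_in_ideal_pow:
  assumes "1 - P \<in> \<I> e"
  shows "1 - P ^ k \<in> \<I> e"
  unfolding one_diff_power_eq
  by (intro ideal_pow_mult_right ideal_pow_sum integral_power assms integral_if_one_minus[OF assms])

lemma cong_mod_1I: "1 - P \<in> \<I> e \<Longrightarrow> P \<cong>\<^bsub>e\<^esub> 1"
  by (rule cong_mod_sym) (auto intro: cong_modI integral_if_one_minus)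

lemma power_cong_linear:
  assumes P: "1 - P \<in> \<I> 1"
  shows "P ^ k \<cong>\<^bsub>2\<^esub> 1 - of_nat k * (1 - P)"
proof (induction k)
  case 0
  show ?case by (simp add: cong_mod_refl integral_1)
next
  case (Suc k)
  note integral = integral_intros integral_if_one_minus[OF P]
  have "P ^ Suc k \<cong>\<^bsub>2\<^esub> P * (1 - of_nat k * (1 - P))"
    unfolding power_Suc by (intro cong_mod_mult cong_mod_refl integral Suc)
  also have "\<dots> \<cong>\<^bsub>2\<^esub> 1 - of_nat (Suc k) * (1 - P)"
    by (rule cong_mod_squareI[OF P, of "of_nat k"]) (intro integral, simp add: algebra_simps)+
  finally show ?case .
qed

lemma one_minus_power_cong:
  assumes "1 - P \<in> \<I> 1"
  shows "1 - P ^ k \<cong>\<^bsub>2\<^esub> of_nat k * (1 - P)"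
  using cong_mod_diff[OF cong_mod_refl[OF integral_1] power_cong_linear[OF assms, of k]] by simp

lemma geometric_sum_cong:
  assumes P: "1 - P \<in> \<I> 1"
  shows "(\<Sum>i<a. P ^ i) \<cong>\<^bsub>2\<^esub> of_nat a - of_nat (a choose 2) * (1 - P)"
proof (induction a)
  case 0
  show ?case by (simp add: cong_mod_refl ideal_pow_0 binomial_eq_0)
next
  case (Suc a)
  have "(\<Sum>i<Suc a. P ^ i) \<cong>\<^bsub>2\<^esub>
      (of_nat a - of_nat (a choose 2) * (1 - P)) + (1 - of_nat a * (1 - P))"
    unfolding sum.lessThan_Suc by (intro cong_mod_add Suc power_cong_linear P)
  also have "\<dots> = of_nat (Suc a) - of_nat (Suc a choose 2) * (1 - P)"
    by (simp add: Suc_choose_2 algebra_simps)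
  finally show ?case .
qed

lemma prod_cong_linear:
  assumes d: "d \<in> \<I> 1" and "\<And>x. x \<in> A \<Longrightarrow> u x \<in> \<I> 0"
  shows "(\<Prod>x\<in>A. 1 + d * u x) \<cong>\<^bsub>2\<^esub> 1 + d * (\<Sum>x\<in>A. u x)"
  using assms(2)
proof (induction A rule: infinite_finite_induct)
  case (insert x A)
  hence integral: "u x \<in> \<I> 0" "(\<Sum>x\<in>A. u x) \<in> \<I> 0" "d \<in> \<I> 0"
    using d by (auto intro: ideal_pow_sum ideal_pow_imp_integral)
  have "(\<Prod>x\<in>insert x A. 1 + d * u x) \<cong>\<^bsub>2\<^esub> (1 + d * u x) * (1 + d * (\<Sum>x\<in>A. u x))"
    using insert by (auto intro!: cong_mod_mult cong_mod_refl integral_intros integral)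
  also have "\<dots> \<cong>\<^bsub>2\<^esub> 1 + d * (u x + (\<Sum>x\<in>A. u x))"
    by (rule cong_mod_squareI[OF d, of "u x * (\<Sum>x\<in>A. u x)"])
       (intro integral_intros integral, simp add: algebra_simps)+
  finally show ?case using insert by simp
qed (auto intro: cong_mod_refl integral_1)

lemma power_cong_mod_period:
  assumes p: "p \<in> \<I> 0" and N: "1 - p ^ N \<in> \<I> 1" and "a mod N = b mod N"
  shows "p ^ a \<cong>\<^bsub>1\<^esub> p ^ b"
proof -
  have reduce: "p ^ k \<cong>\<^bsub>1\<^esub> p ^ (k mod N)" for k
  proof -
    have "p ^ k = (p ^ N) ^ (k div N) * p ^ (k mod N)"
      by (simp flip: power_mult power_add)
    also have "\<dots> \<cong>\<^bsub>1\<^esub> 1 ^ (k div N) * p ^ (k mod N)"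
      by (intro cong_mod_mult cong_mod_power cong_mod_1I N cong_mod_refl integral_power p)
    finally show ?thesis by simp
  qed
  show ?thesis using reduce[of a] cong_mod_sym[OF reduce[of b]] assms(3)
    by (auto intro: cong_mod_trans)
qed

lemma power_quotient_reflect_cong:
  assumes "1 - p ^ (a + b) \<in> \<I> 1" and "1 - p ^ a \<in> \<U>" "1 - p ^ b \<in> \<U>"
  shows "p ^ a / (1 - p ^ a) \<cong>\<^bsub>1\<^esub> - 1 / (1 - p ^ b)"
proof (rule cong_modI)
  have "x / (1 - x) - - 1 / (1 - y) = (1 - x * y) / ((1 - x) * (1 - y))"
    if "1 - x \<noteq> 0" "1 - y \<noteq> 0" for x y :: "'a fract"
    using that by (simp add: divide_simps) (simp add: algebra_simps)
  from this[OF assms(2,3)[THEN units_imp_neq_0]]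
  have "p ^ a / (1 - p ^ a) - - 1 / (1 - p ^ b) = (1 - p ^ (a + b)) / ((1 - p ^ a) * (1 - p ^ b))"
    by (simp only: power_add)
  also have "\<dots> \<in> \<I> 1" by (intro ideal_pow_divide units_mult assms)
  finally show "p ^ a / (1 - p ^ a) - - 1 / (1 - p ^ b) \<in> \<I> 1" .
qed (intro integral_intros assms)

section \<open>First-order expansions of \<open>q\<close>-binomial coefficients\<close>

definition order_exceeds :: "'a fract \<Rightarrow> nat \<Rightarrow> bool" where
  "order_exceeds p k \<longleftrightarrow> (\<forall>i\<in>{1..k}. 1 - p ^ i \<in> \<U>)"

lemma order_exceedsD: "order_exceeds p k \<Longrightarrow> 0 < i \<Longrightarrow> i \<le> k \<Longrightarrow> 1 - p ^ i \<in> \<U>"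
  by (simp add: order_exceeds_def)

(* p ^ h = 1 is excluded because 1 - p ^ h occurs as a denominator in qchoose p (a * h) h. *)
definition has_order :: "'a fract \<Rightarrow> nat \<Rightarrow> bool" where
  "has_order p h \<longleftrightarrow> h > 0 \<and> p \<in> \<I> 0 \<and> p ^ h \<noteq> 1 \<and> 1 - p ^ h \<in> \<I> 1 \<and> order_exceeds p (h - 1)"

lemma has_orderD:
  assumes "has_order p h"
  shows "h > 0" "p \<in> \<I> 0" "p ^ h \<noteq> 1" "1 - p ^ h \<in> \<I> 1"
    and "i \<in> {1..<h} \<Longrightarrow> 1 - p ^ i \<in> \<U>"
  using assms by (auto simp: has_order_def order_exceeds_def)

(* Modulo \<pi> the summands for i and h - i add up to -1. *)
lemma twice_quotient_sum_cong:
  assumes "has_order p h"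
  shows "2 * (\<Sum>i=1..<h. p ^ i / (1 - p ^ i)) \<cong>\<^bsub>1\<^esub> 1 - of_nat h"
proof (rule cong_modI)
  note order = has_orderD[OF assms]
  let ?f = "\<lambda>i. p ^ i / (1 - p ^ i)"
  have units: "1 - p ^ i \<in> \<U>" "1 - p ^ (h - i) \<in> \<U>" if "i \<in> {1..<h}" for i
    using that by (auto intro!: order(5))
  have pair: "?f i + ?f (h - i) + 1 = (1 - p ^ h) / ((1 - p ^ i) * (1 - p ^ (h - i)))"
    if i: "i \<in> {1..<h}" for i
  proof -
    have "x / (1 - x) + y / (1 - y) + 1 = (1 - x * y) / ((1 - x) * (1 - y))"
      if "1 - x \<noteq> 0" "1 - y \<noteq> 0" for x y :: "'a fract"
      using that by (simp add: divide_simps) (simp add: algebra_simps)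
    from this[OF units[OF i, THEN units_imp_neq_0]]
    show ?thesis using i by (simp flip: power_add)
  qed
  have "(\<Sum>i=1..<h. ?f i) = (\<Sum>i=1..<h. ?f (h - i))"
    by (rule sum.reindex_bij_witness[of _ "\<lambda>i. h - i" "\<lambda>i. h - i"]) auto
  hence "2 * (\<Sum>i=1..<h. ?f i) - (1 - of_nat h) = (\<Sum>i=1..<h. ?f i + ?f (h - i) + 1)"
    using order(1) by (simp add: sum.distrib of_nat_diff)
  also have "\<dots> = (\<Sum>i=1..<h. (1 - p ^ h) / ((1 - p ^ i) * (1 - p ^ (h - i))))"
    by (rule sum.cong[OF refl pair])
  also have "\<dots> \<in> \<I> 1"
    by (intro ideal_pow_sum ideal_pow_divide order(4) units_mult units)
  finally show "2 * (\<Sum>i=1..<h. ?f i) - (1 - of_nat h) \<in> \<I> 1" .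
qed (intro integral_intros)

lemma qchoose_multiple_cong_sum:
  assumes "has_order p h"
  shows "qchoose p (Suc c * h) h \<cong>\<^bsub>2\<^esub>
    (1 + of_nat c * (1 - p ^ h) * (\<Sum>i=1..<h. p ^ i / (1 - p ^ i)))
    * (of_nat (Suc c) - of_nat (Suc c choose 2) * (1 - p ^ h))"
proof -
  note order = has_orderD[OF assms]
  let ?P = "p ^ h" and ?S = "\<Sum>i=1..<h. p ^ i / (1 - p ^ i)"
  have summand: "p ^ i / (1 - p ^ i) \<in> \<I> 0" if "i \<in> {1..<h}" for i
    using that by (intro ideal_pow_divide integral_power order)
  have "1 - p ^ i \<noteq> 0" if "0 < i" "i \<le> h" for i
    using that order(3) order(5)[of i, THEN units_imp_neq_0] by (cases "i = h") auto
  hence "qchoose p (Suc c * h) h =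
      (\<Prod>i=1..<h. 1 + (1 - ?P ^ c) * (p ^ i / (1 - p ^ i))) * (\<Sum>i<Suc c. ?P ^ i)"
    using order(1) by (rule qchoose_multiple)
  also have "\<dots> \<cong>\<^bsub>2\<^esub> (1 + (1 - ?P ^ c) * ?S) * (of_nat (Suc c) - of_nat (Suc c choose 2) * (1 - ?P))"
    by (intro cong_mod_mult prod_cong_linear geometric_sum_cong order
          one_minus_power_in_ideal_pow summand)
  also have "\<dots> \<cong>\<^bsub>2\<^esub> (1 + of_nat c * (1 - ?P) * ?S)
      * (of_nat (Suc c) - of_nat (Suc c choose 2) * (1 - ?P))"
    by (intro cong_mod_mult cong_mod_add one_minus_power_cong order cong_mod_refl integral_intros
          ideal_pow_sum[OF summand])
  finally show ?thesis .
qed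

lemma qchoose_multiple_cong:
  assumes "has_order p h" "a > 0"
  shows "qchoose p (a * h) h \<cong>\<^bsub>2\<^esub> of_nat a - of_nat h * of_nat (a choose 2) * (1 - p ^ h)"
proof -
  note order = has_orderD[OF assms(1)]
  obtain c where a_eq: "a = Suc c" using assms(2) by (cases a) auto
  define S where "S = (\<Sum>i=1..<h. p ^ i / (1 - p ^ i))"
  let ?d = "1 - p ^ h" and ?b = "of_nat (a choose 2) :: 'a fract"
  have "S \<in> \<I> 0" unfolding S_def by (intro ideal_pow_sum ideal_pow_divide integral_power order)
  note integral = integral_intros this order(2)
  have "qchoose p (a * h) h \<cong>\<^bsub>2\<^esub> (1 + of_nat c * ?d * S) * (of_nat a - ?b * ?d)"
    unfolding a_eq S_def by (rule qchoose_multiple_cong_sum[OF assms(1)])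
  also have "\<dots> \<cong>\<^bsub>2\<^esub> of_nat a - ?b * ?d + ?d * (?b * (2 * S))"
  proof (rule cong_mod_squareI[OF order(4), of "- (of_nat c * S * ?b)"])
    have "?b * (2 * S) = of_nat a * of_nat c * S"
      using of_nat_choose_2[of a, where 'a = "'a fract"] by (simp add: a_eq mult_ac)
    thus "(1 + of_nat c * ?d * S) * (of_nat a - ?b * ?d) - (of_nat a - ?b * ?d + ?d * (?b * (2 * S)))
        = ?d * (?d * - (of_nat c * S * ?b))"
      by (simp only:) (simp add: algebra_simps)
  qed (intro integral)+
  also have "\<dots> \<cong>\<^bsub>2\<^esub> of_nat a - ?b * ?d + ?d * (?b * (1 - of_nat h))"
    unfolding S_def
    by (intro cong_mod_add cong_mod_2_mult cong_mod_mult cong_mod_refl order twice_quotient_sum_cong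
          assms(1) integral)
  also have "\<dots> = of_nat a - of_nat h * ?b * ?d"
    by (simp add: algebra_simps)
  finally show ?thesis .
qed

lemma qchoose_multiple_cong_of_nat:
  assumes "has_order p h" "a > 0"
  shows "qchoose p (a * h) h \<cong>\<^bsub>1\<^esub> of_nat a"
proof -
  have "qchoose p (a * h) h \<cong>\<^bsub>1\<^esub> of_nat a - of_nat h * of_nat (a choose 2) * (1 - p ^ h)"
    using qchoose_multiple_cong[OF assms] by (rule cong_mod_antimono) simp
  also have "\<dots> \<cong>\<^bsub>1\<^esub> of_nat a - 0"
    by (intro cong_mod_diff cong_mod_refl integral_of_nat cong_mod_0_iff[THEN iffD2]
          ideal_pow_mult_left integral_mult has_orderD(4)[OF assms(1)])
  finally show ?thesis by simp
qed

lemma qchoose_central_unit: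
  assumes "has_order p h" "infinite_order p" "2 \<in> \<U>"
  shows "qchoose p (2 * h) h \<in> \<U>"
proof (rule units_perturb)
  show "qchoose p (2 * h) h \<noteq> 0" by (rule qchoose_neq_0[OF assms(2)]) simp
  show "qchoose p (2 * h) h - 2 \<in> \<I> 1"
    using qchoose_multiple_cong_of_nat[OF assms(1), of 2] by (simp add: cong_mod_def)
qed (rule assms)

lemma multiple_expansions_product_cong:
  assumes d: "d \<in> \<I> 1"
  shows "(of_nat (2 * c + 2) - of_nat h * of_nat ((2 * c + 2) choose 2) * d)
      * (of_nat (2 * c + 1) - of_nat h * of_nat ((2 * c + 1) choose 2) * d)
    \<cong>\<^bsub>2\<^esub> (2 * of_nat c + 1) * (of_nat c + 1 - of_nat (2 * h) * (of_nat c + 1) * of_nat c * d)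
      * (2 - of_nat h * d)"
proof (rule cong_mod_squareI[OF d])
  let ?k = "of_nat h :: 'a fract" and ?c = "of_nat c :: 'a fract"
  note integral = integral_intros d[THEN ideal_pow_imp_integral]
  show "?k\<^sup>2 * (?c + 1) * ?c * (2 * ?c + 1) * (2 * ?c - 1) \<in> \<I> 0"
    "(2 * ?c + 1) * (?c + 1 - of_nat (2 * h) * (?c + 1) * ?c * d) * (2 - ?k * d) \<in> \<I> 0"
    by (intro integral)+
  have "(2 * c + 2) choose 2 = (c + 1) * (2 * c + 1)" "(2 * c + 1) choose 2 = (2 * c + 1) * c"
    by (simp_all add: choose_two algebra_simps)
  hence of_nat: "of_nat ((2 * c + 2) choose 2) = (?c + 1) * (2 * ?c + 1)"
    "of_nat ((2 * c + 1) choose 2) = (2 * ?c + 1) * ?c"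
    "of_nat (2 * c + 2) = 2 * ?c + 2" "of_nat (2 * c + 1) = 2 * ?c + 1" "of_nat (2 * h) = 2 * ?k"
    by (simp_all add: algebra_simps)
  show "(of_nat (2 * c + 2) - ?k * of_nat ((2 * c + 2) choose 2) * d)
        * (of_nat (2 * c + 1) - ?k * of_nat ((2 * c + 1) choose 2) * d)
      - (2 * ?c + 1) * (?c + 1 - of_nat (2 * h) * (?c + 1) * ?c * d) * (2 - ?k * d)
    = d * (d * (?k\<^sup>2 * (?c + 1) * ?c * (2 * ?c + 1) * (2 * ?c - 1)))"
    unfolding of_nat by algebra
qed

(* The denominator of the left-hand side contains the non-unit factor 1 - p^h; multiplying by the
   unit [2h, h] reduces it to bottom index h. *)
lemma qchoose_double_cong:
  assumes order: "has_order p h" and p: "infinite_order p" and "2 \<in> \<U>" "m > 0"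
  shows "qchoose p (m * (2 * h)) (2 * h) \<cong>\<^bsub>2\<^esub>
    (2 * of_nat m - 1) * (of_nat m - of_nat (2 * h) * of_nat m * (of_nat m - 1) * (1 - p ^ h))"
    (is "?B \<cong>\<^bsub>2\<^esub> ?R")
proof -
  let ?D = "qchoose p (2 * h) h" and ?d = "1 - p ^ h"
  have unit: "?D \<in> \<U>" by (intro qchoose_central_unit assms)
  have central: "2 - of_nat h * ?d \<cong>\<^bsub>2\<^esub> ?D"
    using cong_mod_sym[OF qchoose_multiple_cong[OF order, of 2]] by simp
  obtain c where m_eq: "m = c + 1" using assms(4) by (metis Suc_eq_plus1 gr0_implies_Suc)
  have "?B * ?D = qchoose p ((2 * c + 2) * h) h * qchoose p ((2 * c + 1) * h) h"
    using qchoose_mult[OF p, of h "2 * h" "m * (2 * h)"] by (simp add: m_eq algebra_simps)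
  also have "\<dots> \<cong>\<^bsub>2\<^esub> (of_nat (2 * c + 2) - of_nat h * of_nat ((2 * c + 2) choose 2) * ?d)
      * (of_nat (2 * c + 1) - of_nat h * of_nat ((2 * c + 1) choose 2) * ?d)"
    by (intro cong_mod_mult qchoose_multiple_cong order) simp_all
  also have "\<dots> \<cong>\<^bsub>2\<^esub> (2 * of_nat c + 1)
      * (of_nat c + 1 - of_nat (2 * h) * (of_nat c + 1) * of_nat c * ?d) * (2 - of_nat h * ?d)"
    by (rule multiple_expansions_product_cong[OF has_orderD(4)[OF order]])
  also have "\<dots> = ?R * (2 - of_nat h * ?d)" by (simp add: m_eq add.commute)
  also have "\<dots> \<cong>\<^bsub>2\<^esub> ?R * ?D"
    by (intro cong_mod_mult cong_mod_refl central integral_intros has_orderD(2)[OF order])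
  finally have "?B * ?D / ?D \<cong>\<^bsub>2\<^esub> ?R * ?D / ?D" using unit by (rule cong_mod_divide_right)
  thus ?thesis using unit by (simp add: units_imp_neq_0)
qed

lemma one_minus_power_reflect_cong:
  assumes "p \<in> \<U>" "1 - p ^ N \<in> \<I> 1" "s \<le> N"
  shows "1 - p ^ (N - s) \<cong>\<^bsub>1\<^esub> - (1 - p ^ s) / p ^ s"
proof (rule cong_modI)
  have "p ^ N = p ^ (N - s) * p ^ s" using assms(3) by (simp flip: power_add)
  hence "(1 - p ^ (N - s)) - (- (1 - p ^ s) / p ^ s) = (1 - p ^ N) / p ^ s"
    using units_imp_neq_0[OF assms(1)] by (simp add: field_simps)
  thus "(1 - p ^ (N - s)) - (- (1 - p ^ s) / p ^ s) \<in> \<I> 1"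
    using assms by (simp only: ideal_pow_divide units_power)
qed (intro integral_intros units_power units_imp_integral assms)

(* Modulo \<pi> the top index N - b - 1 acts as -b - 1, so this is upper negation. *)
lemma qchoose_reflect_cong:
  assumes p: "p \<in> \<U>" and N: "1 - p ^ N \<in> \<I> 1" and ord: "order_exceeds p k" and "b + k \<le> N"
  shows "qchoose p (N - Suc b) k \<cong>\<^bsub>1\<^esub>
    (-1) ^ k / p ^ (b * k + (Suc k choose 2)) * qchoose p (b + k) k"
proof -
  have "qchoose p (N - Suc b) k = (\<Prod>i=1..k. (1 - p ^ (N - (b + i))) / (1 - p ^ i))"
    unfolding qchoose_def using assms(4)
    by (intro prod.cong arg_cong2[where f = "(/)"] arg_cong[where f = "\<lambda>x. 1 - p ^ x"]) auto
  also have "\<dots> \<cong>\<^bsub>1\<^esub> (\<Prod>i=1..k. (- (1 - p ^ (b + i)) / p ^ (b + i)) / (1 - p ^ i))"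
    using assms(4)
    by (intro cong_mod_prod cong_mod_divide_right one_minus_power_reflect_cong p N
          order_exceedsD[OF ord]) auto
  also have "(\<Prod>i=1..k. (- (1 - p ^ (b + i)) / p ^ (b + i)) / (1 - p ^ i))
      = (\<Prod>i=1..k. - 1 / p ^ (b + i)) * (\<Prod>i=1..k. (1 - p ^ (b + i)) / (1 - p ^ i))"
    unfolding prod.distrib[symmetric] by (intro prod.cong refl) (simp del: minus_diff_eq)
  finally show ?thesis unfolding prod_uminus_inverse_powers qchoose_add_left .
qed

lemma qchoose_pred_cong:
  assumes "p \<in> \<U>" "1 - p ^ N \<in> \<I> 1" "order_exceeds p k" "k \<le> N"
  shows "qchoose p (N - 1) k \<cong>\<^bsub>1\<^esub> (-1) ^ k / p ^ (Suc k choose 2)"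
proof -
  have "qchoose p k k = 1"
    using order_exceedsD[OF assms(3)] by (intro qchoose_self units_imp_neq_0) auto
  thus ?thesis using qchoose_reflect_cong[OF assms(1-3), of 0] assms(4) by simp
qed

lemma qchoose_add_period_cong:
  assumes p: "p \<in> \<I> 0" and N: "1 - p ^ N \<in> \<I> 1" and ord: "order_exceeds p k"
  shows "qchoose p (N + a + k) k \<cong>\<^bsub>1\<^esub> qchoose p (a + k) k"
  unfolding qchoose_add_left
proof (intro cong_mod_prod cong_mod_divide_right)
  fix i assume "i \<in> {1..k}"
  thus "1 - p ^ i \<in> \<U>" using ord by (simp add: order_exceeds_def)
  have "1 - p ^ N * p ^ (a + i) \<cong>\<^bsub>1\<^esub> 1 - 1 * p ^ (a + i)"
    by (intro cong_mod_diff cong_mod_mult cong_mod_1I[OF N] cong_mod_refl integral_1 integral_power p)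
  thus "1 - p ^ (N + a + i) \<cong>\<^bsub>1\<^esub> 1 - p ^ (a + i)" by (simp add: power_add mult.assoc)
qed

(* The factor of the product at the period h is congruent to a - 1 instead of -1 / p^h, which
   is congruent to -1. *)
lemma qchoose_pred_period_cong:
  assumes p: "p \<in> \<U>" and order: "has_order p h" and "h \<in> {1..k}" "k < a * h"
    and units: "\<And>l. l \<in> {1..k} - {h} \<Longrightarrow> 1 - p ^ l \<in> \<U>"
  shows "qchoose p (a * h - 1) k \<cong>\<^bsub>1\<^esub> - (of_nat (a - 1) * ((-1) ^ k / p ^ (Suc k choose 2)))"
proof -
  let ?f = "\<lambda>l. (1 - p ^ (a * h - l)) / (1 - p ^ l)" and ?g = "\<lambda>l. - 1 / p ^ l"
  have period: "p ^ h \<cong>\<^bsub>1\<^esub> 1" by (rule cong_mod_1I[OF has_orderD(4)[OF order]])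
  have "p ^ (a * h - h) = (p ^ h) ^ (a - 1)"
    by (simp add: diff_mult_distrib2 mult.commute flip: power_mult)
  hence at_period: "?f h = (\<Sum>i<a - 1. (p ^ h) ^ i)"
    using has_orderD(3)[OF order] one_diff_power_eq[of "p ^ h" "a - 1"] by simp
  have "?f l \<cong>\<^bsub>1\<^esub> ?g l" if l: "l \<in> {1..k} - {h}" for l
  proof -
    have "1 - p ^ (a * h) \<in> \<I> 1"
      using one_minus_power_in_ideal_pow[OF has_orderD(4)[OF order], of a]
      by (simp add: mult.commute flip: power_mult)
    hence "?f l \<cong>\<^bsub>1\<^esub> - (1 - p ^ l) / p ^ l / (1 - p ^ l)"
      using l assms(4) by (intro cong_mod_divide_right one_minus_power_reflect_cong p units) auto
    also have "- (1 - p ^ l) / p ^ l / (1 - p ^ l) = ?g l"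
      using units_imp_neq_0[OF units[OF l]] by (simp add: divide_simps)
    finally show ?thesis .
  qed
  hence away: "(\<Prod>l\<in>{1..k} - {h}. ?f l) \<cong>\<^bsub>1\<^esub> (\<Prod>l\<in>{1..k} - {h}. ?g l)"
    by (rule cong_mod_prod)
  have "a * h - 1 + 1 = a * h" using assms(4) by simp
  hence "qchoose p (a * h - 1) k = (\<Prod>l=1..k. ?f l)"
    unfolding qchoose_def by (simp only:)
  also have "\<dots> = (\<Sum>i<a - 1. (p ^ h) ^ i) * (\<Prod>l\<in>{1..k} - {h}. ?f l)"
    unfolding at_period[symmetric] using assms(3) by (intro prod.remove) simp_all
  also have "\<dots> \<cong>\<^bsub>1\<^esub> (\<Sum>i<a - 1. 1 ^ i) * (\<Prod>l\<in>{1..k} - {h}. ?g l)"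
    by (intro cong_mod_mult cong_mod_sum cong_mod_power period away)
  also have "\<dots> = - of_nat (a - 1) * (p ^ h * (\<Prod>l=1..k. ?g l))"
    unfolding prod.remove[OF finite_atLeastAtMost assms(3)] using units_imp_neq_0[OF p] by simp
  also have "\<dots> \<cong>\<^bsub>1\<^esub> - of_nat (a - 1) * (1 * (\<Prod>l=1..k. ?g l))"
    by (intro cong_mod_mult cong_mod_refl period integral_intros units_power p)
  finally show ?thesis using prod_uminus_inverse_powers[of p 0 k] by simp
qed

lemma qchoose_in_ideal_pow:
  assumes p: "p \<in> \<I> 0" and ord: "order_exceeds p k" and "N \<le> n" "n < N + k" and N: "1 - p ^ N \<in> \<I> e"
  shows "qchoose p n k \<in> \<I> e"
proof -
  let ?f = "\<lambda>i. (1 - p ^ (n + 1 - i)) / (1 - p ^ i)" and ?i = "n + 1 - N"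
  have i: "?i \<in> {1..k}" "n + 1 - ?i = N" using assms(3,4) by auto
  hence "qchoose p n k = ?f ?i * (\<Prod>i\<in>{1..k} - {?i}. ?f i)"
    unfolding qchoose_def by (intro prod.remove) simp_all
  moreover have "?f ?i \<in> \<I> e"
    unfolding i(2) using ord i(1) by (intro ideal_pow_divide N) (simp add: order_exceeds_def)
  moreover have "?f i \<in> \<I> 0" if "i \<in> {1..k} - {?i}" for i
    using ord that by (intro integral_intros p) (simp add: order_exceeds_def)
  ultimately show ?thesis by (simp only: ideal_pow_mult_right integral_prod)
qed

lemma qchoose_absorption_cong:
  assumes P: "1 - P \<in> \<I> 1" "p ^ n = P ^ a" and k: "0 < k" "k \<le> n" "1 - p ^ k \<in> \<U>"
    and X: "qchoose p (n - 1) (k - 1) \<cong>\<^bsub>1\<^esub> X"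
  shows "qchoose p n k \<cong>\<^bsub>2\<^esub> (1 - P) * (of_nat a * X / (1 - p ^ k))"
proof -
  let ?A = "qchoose p (n - 1) (k - 1)"
  have "qchoose p n k = (1 - P ^ a) * (?A / (1 - p ^ k))"
    unfolding qchoose_absorption[OF k(1,2)] P(2) by simp
  also have "\<dots> \<cong>\<^bsub>2\<^esub> of_nat a * (1 - P) * (?A / (1 - p ^ k))"
    by (intro cong_mod_mult one_minus_power_cong P cong_mod_refl ideal_pow_divide k
          cong_mod_imp_integral[OF X])
  also have "\<dots> = (1 - P) * (of_nat a * ?A / (1 - p ^ k))" by simp
  also have "\<dots> \<cong>\<^bsub>2\<^esub> (1 - P) * (of_nat a * X / (1 - p ^ k))"
    by (intro cong_mod_2_mult P cong_mod_divide_right cong_mod_mult cong_mod_refl X k integral_of_nat)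
  finally show ?thesis .
qed

end

section \<open>The localization at a cyclotomic polynomial\<close>

lemma qvar_power: "qvar ^ i = to_fract (monom 1 i)"
proof (induction i)
  case (Suc i)
  have "monom (1::int) (Suc i) = [:0, 1:] * monom 1 i" by (simp add: monom_Suc)
  thus ?case by (simp only: power_Suc Suc to_fract_mult qvar_def[symmetric])
qed (simp add: monom_0 flip: one_pCons)

lemma qvar_neq_0: "qvar \<noteq> 0"
  by (simp add: qvar_def)

lemma infinite_order_qvar: "infinite_order qvar"
  unfolding infinite_order_def qvar_power
  by (metis monom_eq_1_iff not_gr0 to_fract_1 to_fract_eq_iff)

lemma infinite_order_qvar_sq: "infinite_order (qvar\<^sup>2)"
  by (intro infinite_order_power infinite_order_qvar) simp

locale cyclotomic_localization = localization "cyclotomic n" for n :: nat +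
  assumes n_pos: "n > 0"
begin

notation ideal_pow ("\<I>") and units ("\<U>") and cong_mod ("(_ \<cong>\<^bsub>_\<^esub>/ _)" [51, 0, 51] 50)

lemma ratfun_congI:
  assumes "f \<cong>\<^bsub>e\<^esub> g"
  shows "ratfun_cong f g (cyclotomic n ^ e)"
proof -
  have "f - g \<in> \<I> e" using assms by (simp add: cong_mod_def)
  then obtain a b where "b \<noteq> 0" "coprime b (cyclotomic n)" "f - g = Fract (cyclotomic n ^ e * a) b"
    by (rule ideal_powE)
  moreover from this have "coprime b (cyclotomic n ^ e)" by simp
  ultimately show ?thesis unfolding ratfun_cong_def by (metis dvd_triv_left)
qed

lemma units_of_nat:
  assumes "k > 0"
  shows "of_nat k \<in> \<U>"
proof -
  have "complex_poly (of_nat k) = of_nat k" by (simp add: of_nat_poly map_poly_pCons)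
  hence "coprime (of_nat k) (cyclotomic n)"
    using assms by (intro coprime_cyclotomicI[OF n_pos]) simp
  hence "to_fract (of_nat k) \<in> \<U>" using assms by (intro units_to_fract) simp_all
  thus ?thesis by (simp add: of_nat_fract to_fract_def)
qed

lemma units_qvar: "qvar \<in> \<U>"
  unfolding qvar_def
proof (intro units_to_fract coprime_cyclotomicI[OF n_pos])
  fix z assume "z \<in> primitive_roots n"
  hence "z \<noteq> 0" using n_pos by (auto simp: primitive_roots_def zero_power)
  thus "poly (complex_poly [:0, 1:]) z \<noteq> 0" by (simp add: map_poly_pCons)
qed simp

lemma units_one_minus_qvar_power:
  assumes "\<not> n dvd i"
  shows "1 - qvar ^ i \<in> \<U>"
proof -
  have complex: "complex_poly (1 - monom 1 i) = 1 - monom 1 i"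
    by (rule poly_eqI) (simp add: coeff_map_poly)
  have "monom (1::int) i \<noteq> 1" using assms by (metis monom_eq_1_iff dvd_0_right)
  hence "to_fract (1 - monom 1 i) \<in> \<U>"
    using assms primitive_root_power_eq_1_iff[OF n_pos]
    by (intro units_to_fract coprime_cyclotomicI[OF n_pos]) (simp_all add: complex poly_monom)
  thus ?thesis by (simp add: qvar_power)
qed

lemma one_minus_qvar_power_n: "1 - qvar ^ n \<in> \<I> 1"
proof -
  obtain a where "monom 1 n - 1 = cyclotomic n * a"
    using cyclotomic_dvd_monom_minus_1[OF n_pos] by (rule dvdE)
  hence "1 - monom 1 n = cyclotomic n ^ 1 * (- a)" by (simp add: algebra_simps)
  hence "1 - qvar ^ n = Fract (cyclotomic n ^ 1 * (- a)) 1"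
    unfolding qvar_power to_fract_def[symmetric] by (metis to_fract_1 to_fract_diff)
  also have "\<dots> \<in> \<I> 1" by (rule ideal_powI) simp_all
  finally show ?thesis .
qed

lemma one_minus_qvar_power:
  assumes "n dvd i"
  shows "1 - qvar ^ i \<in> \<I> 1"
  using assms one_minus_power_in_ideal_pow[OF one_minus_qvar_power_n]
  by (auto simp: power_mult elim!: dvdE)

lemma integral_qvar: "qvar \<in> \<I> 0"
  using units_qvar by (rule units_imp_integral)

lemma order_exceeds_qvar: "k < n \<Longrightarrow> order_exceeds qvar k"
  by (auto simp: order_exceeds_def intro!: units_one_minus_qvar_power dest: dvd_imp_le)

lemma qvar_sq_power: "(qvar\<^sup>2) ^ i = qvar ^ (2 * i)"
  by (simp add: power_mult)

lemma units_one_minus_qvar_power_double: "0 < i \<Longrightarrow> i < n \<Longrightarrow> 2 * i \<noteq> n \<Longrightarrow> 1 - qvar ^ (2 * i) \<in> \<U>"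
  by (intro units_one_minus_qvar_power not_dvd_double)

lemma order_exceeds_qvar_sq:
  assumes "k < n" "odd n \<or> 2 * k < n"
  shows "order_exceeds (qvar\<^sup>2) k"
  unfolding order_exceeds_def qvar_sq_power
proof
  fix i assume "i \<in> {1..k}"
  hence "0 < i" "i < n" "2 * i \<noteq> n" using assms by auto
  thus "1 - qvar ^ (2 * i) \<in> \<U>" by (rule units_one_minus_qvar_power_double)
qed

lemma has_order_qvar: "has_order qvar n"
  using n_pos one_minus_qvar_power_n infinite_orderD[OF infinite_order_qvar]
  by (simp add: has_order_def integral_qvar order_exceeds_qvar)

lemma has_order_qvar_sq_odd:
  assumes "odd n"
  shows "has_order (qvar\<^sup>2) n"
proof -
  have "1 - (qvar\<^sup>2) ^ n \<in> \<I> 1"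
    unfolding qvar_sq_power by (rule one_minus_qvar_power) simp
  moreover have "order_exceeds (qvar\<^sup>2) (n - 1)"
    by (rule order_exceeds_qvar_sq) (use n_pos assms in simp_all)
  ultimately show ?thesis
    unfolding has_order_def
    by (intro conjI n_pos infinite_orderD[OF infinite_order_qvar_sq] integral_power integral_qvar)
qed

lemma has_order_qvar_sq_even:
  assumes "n = 2 * h"
  shows "has_order (qvar\<^sup>2) h"
proof -
  have "h > 0" using n_pos assms by simp
  moreover have "1 - (qvar\<^sup>2) ^ h \<in> \<I> 1"
    using one_minus_qvar_power_n by (simp only: qvar_sq_power assms)
  moreover have "order_exceeds (qvar\<^sup>2) (h - 1)"
    by (rule order_exceeds_qvar_sq) (use assms \<open>h > 0\<close> in auto)
  ultimately show ?thesis
    unfolding has_order_def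
    by (intro conjI infinite_orderD[OF infinite_order_qvar_sq] integral_power integral_qvar)
qed

lemmas qvar_intros = units_qvar units_power integral_qvar one_minus_qvar_power_n

section \<open>The trinomial coefficient modulo the square of a cyclotomic polynomial\<close>

definition parity_factor :: "nat \<Rightarrow> int poly fract" where
  "parity_factor m = (-1) ^ n * ((1 + (-1) ^ n) * (of_nat m - 1) + 1)"

lemma parity_factor_odd: "odd n \<Longrightarrow> parity_factor m = - 1"
  and parity_factor_even: "even n \<Longrightarrow> parity_factor m = 2 * of_nat m - 1"
  by (simp_all add: parity_factor_def algebra_simps)

lemma integral_parity_factor: "parity_factor m \<in> \<I> 0"
  unfolding parity_factor_def by (intro integral_intros)

lemma qchoose_sq_n_cong:
  assumes "m > 0"
  shows "qchoose (qvar\<^sup>2) (m * n) n \<cong>\<^bsub>2\<^esub>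
    (-1) ^ n * parity_factor m * (of_nat m - of_nat n * of_nat m * (of_nat m - 1) * (1 - qvar ^ n))"
proof (cases "even n")
  case True
  then obtain h where n_eq: "n = 2 * h" by (elim evenE)
  have "2 \<in> \<U>" using units_of_nat[of 2] by simp
  hence "qchoose (qvar\<^sup>2) (m * (2 * h)) (2 * h) \<cong>\<^bsub>2\<^esub> (2 * of_nat m - 1) *
      (of_nat m - of_nat (2 * h) * of_nat m * (of_nat m - 1) * (1 - (qvar\<^sup>2) ^ h))"
    by (intro qchoose_double_cong has_order_qvar_sq_even n_eq infinite_order_qvar_sq assms)
  moreover have "(qvar\<^sup>2) ^ h = qvar ^ n" by (simp only: qvar_sq_power n_eq)
  ultimately show ?thesis using True unfolding n_eq[symmetric] by (simp add: parity_factor_even)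
next
  case False
  have "qchoose (qvar\<^sup>2) (m * n) n \<cong>\<^bsub>2\<^esub>
      of_nat m - of_nat n * of_nat (m choose 2) * (1 - (qvar\<^sup>2) ^ n)"
    by (intro qchoose_multiple_cong has_order_qvar_sq_odd False assms)
  also have "(qvar\<^sup>2) ^ n = (qvar ^ n) ^ 2" by (simp flip: power_mult add: mult.commute)
  also have "of_nat m - of_nat n * of_nat (m choose 2) * (1 - (qvar ^ n) ^ 2) \<cong>\<^bsub>2\<^esub>
      of_nat m - of_nat n * of_nat (m choose 2) * (of_nat 2 * (1 - qvar ^ n))"
    by (intro cong_mod_diff cong_mod_mult one_minus_power_cong one_minus_qvar_power_n
          cong_mod_refl integral_mult integral_of_nat)
  also have "\<dots> = of_nat m - of_nat n * (2 * of_nat (m choose 2)) * (1 - qvar ^ n)" by simp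
  finally show ?thesis
    unfolding of_nat_choose_2 using False by (simp add: parity_factor_odd mult.assoc)
qed

lemma qchoose_sq_pred_cong_even:
  assumes "m > 0" "n = 2 * h" "h \<le> k" "k < n"
  shows "qchoose (qvar\<^sup>2) (m * n - 1) k \<cong>\<^bsub>1\<^esub>
    - (of_nat (2 * m - 1) * ((-1) ^ k / (qvar\<^sup>2) ^ (Suc k choose 2)))"
proof -
  have "n \<le> m * n" "m * n = 2 * m * h" using assms(1,2) by simp_all
  moreover have "qchoose (qvar\<^sup>2) (2 * m * h - 1) k \<cong>\<^bsub>1\<^esub>
    - (of_nat (2 * m - 1) * ((-1) ^ k / (qvar\<^sup>2) ^ (Suc k choose 2)))"
  proof (rule qchoose_pred_period_cong)
    show "h \<in> {1..k}" using assms(2,3) n_pos by simp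
    show "k < 2 * m * h" using calculation assms(4) by linarith
    show "1 - (qvar\<^sup>2) ^ i \<in> \<U>" if "i \<in> {1..k} - {h}" for i
      using that assms(2,4) unfolding qvar_sq_power
      by (intro units_one_minus_qvar_power_double) auto
  qed (intro qvar_intros has_order_qvar_sq_even assms)+
  ultimately show ?thesis by (simp only:)
qed

lemma qchoose_sq_pred_cong_odd:
  assumes "m > 0" "odd n" "k < n"
  shows "qchoose (qvar\<^sup>2) (m * n - 1) k \<cong>\<^bsub>1\<^esub> (-1) ^ k / (qvar\<^sup>2) ^ (Suc k choose 2)"
proof (rule qchoose_pred_cong)
  show "1 - (qvar\<^sup>2) ^ (m * n) \<in> \<I> 1"
    unfolding qvar_sq_power by (rule one_minus_qvar_power) simp
  have "n \<le> m * n" using assms(1) by simp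
  thus "k \<le> m * n" using assms(3) by linarith
qed (use assms in \<open>auto intro!: qvar_intros order_exceeds_qvar_sq\<close>)

lemma qchoose_sq_pred_cong:
  assumes "m > 0" "k < n" "n < 2 * k"
  shows "qchoose (qvar\<^sup>2) (m * n - 1) (k - 1) \<cong>\<^bsub>1\<^esub>
    (-1) ^ k * parity_factor m / qvar ^ (k * (k - 1))"
proof -
  obtain l where k_eq: "k = Suc l" using assms(3) by (cases k) auto
  have power: "(qvar\<^sup>2) ^ (Suc l choose 2) = qvar ^ (k * l)"
    using double_choose_2[of "Suc l"] by (simp only: qvar_sq_power k_eq diff_Suc_1)
  have "qchoose (qvar\<^sup>2) (m * n - 1) l \<cong>\<^bsub>1\<^esub>
      - (parity_factor m * ((-1) ^ l / (qvar\<^sup>2) ^ (Suc l choose 2)))"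
  proof (cases "even n")
    case True
    then obtain h where n_eq: "n = 2 * h" by (elim evenE)
    have "h \<le> l" "l < n" using assms by (simp_all add: n_eq k_eq)
    moreover have "parity_factor m = of_nat (2 * m - 1)"
      using assms(1) True by (simp add: parity_factor_even of_nat_diff)
    ultimately show ?thesis using qchoose_sq_pred_cong_even[OF assms(1) n_eq] by simp
  next
    case False
    have "l < n" using assms(2) k_eq by simp
    thus ?thesis using qchoose_sq_pred_cong_odd[OF assms(1) False] False
      by (simp add: parity_factor_odd)
  qed
  thus ?thesis unfolding power k_eq by (simp add: mult.commute)
qed

lemma qchoose_sq_cong:
  assumes "m > 0" "k < n" "n < 2 * k"
  shows "qchoose (qvar\<^sup>2) (m * n) k \<cong>\<^bsub>2\<^esub> (1 - qvar ^ n) *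
    (of_nat (2 * m) * ((-1) ^ k * parity_factor m / qvar ^ (k * (k - 1))) / (1 - qvar ^ (2 * k)))"
proof -
  have "qchoose (qvar\<^sup>2) (m * n) k \<cong>\<^bsub>2\<^esub> (1 - qvar ^ n) *
    (of_nat (2 * m) * ((-1) ^ k * parity_factor m / qvar ^ (k * (k - 1))) / (1 - (qvar\<^sup>2) ^ k))"
  proof (rule qchoose_absorption_cong)
    show "(qvar\<^sup>2) ^ (m * n) = (qvar ^ n) ^ (2 * m)" by (simp add: mult_ac flip: power_mult)
    have "n \<le> m * n" using assms(1) by simp
    thus "0 < k" "k \<le> m * n" using assms by linarith+
    show "1 - (qvar\<^sup>2) ^ k \<in> \<U>"
      unfolding qvar_sq_power using assms by (intro units_one_minus_qvar_power_double) auto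
  qed (intro one_minus_qvar_power_n qchoose_sq_pred_cong assms)+
  thus ?thesis by (simp only: qvar_sq_power)
qed

lemma qlucas_term_cong:
  assumes "0 < j" "2 * j < n"
  shows "qlucas_term qvar n j \<cong>\<^bsub>2\<^esub>
    (1 - qvar ^ n) * - (qchoose qvar (2 * j) j / (qvar ^ (j * j) * (1 - qvar ^ (2 * j))))"
proof -
  obtain i where j_eq: "j = Suc i" using assms(1) by (cases j) auto
  define R where "R = qchoose qvar (j + i) i"
  define c where "c = (-1) ^ j * qvar ^ (j choose 2) / qvar ^ j / (1 - qvar ^ j)"
  have units: "1 - qvar ^ j \<in> \<U>" "1 - qvar ^ (2 * j) \<in> \<U>"
    using order_exceedsD[OF order_exceeds_qvar, of "2 * j"] assms by simp_all
  have "qchoose qvar (n - Suc j) i \<cong>\<^bsub>1\<^esub> (-1) ^ i / qvar ^ (j * i + (j choose 2)) * R"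
    unfolding R_def j_eq using assms
    by (intro qchoose_reflect_cong qvar_intros order_exceeds_qvar) (auto simp: j_eq)
  moreover have "qlucas_term qvar n j = (1 - qvar ^ n) * (c * qchoose qvar (n - Suc j) i)"
    by (simp add: qlucas_term_def c_def j_eq)
  ultimately have "qlucas_term qvar n j
      \<cong>\<^bsub>2\<^esub> (1 - qvar ^ n) * (c * ((-1) ^ i / qvar ^ (j * i + (j choose 2)) * R))"
    unfolding c_def
    by (simp only:) (intro cong_mod_2_mult cong_mod_mult cong_mod_refl integral_intros
        qvar_intros units)
  also have "c * ((-1) ^ i / qvar ^ (j * i + (j choose 2)) * R)
      = - (R / (1 - qvar ^ j) / qvar ^ (j * j))"
  proof -
    have "qvar ^ (j * j) = qvar ^ j * qvar ^ (j * i)" by (simp add: j_eq flip: power_add)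
    moreover have "(-1) ^ j * (-1) ^ i = (- 1 :: int poly fract)"
      by (simp add: j_eq flip: power_mult_distrib)
    ultimately show ?thesis
      using qvar_neq_0 by (simp add: c_def power_add mult_ac)
  qed
  also have "R / (1 - qvar ^ j) = qchoose qvar (2 * j) j / (1 - qvar ^ (2 * j))"
  proof -
    have "2 * j - 1 = j + i" "j - 1 = i" by (simp_all add: j_eq)
    hence "qchoose qvar (2 * j) j = (1 - qvar ^ (2 * j)) / (1 - qvar ^ j) * R"
      using qchoose_absorption[of j "2 * j" qvar] assms(1) by (simp add: R_def)
    thus ?thesis using units[THEN units_imp_neq_0] by simp
  qed
  finally show ?thesis by (simp only: divide_divide_eq_left mult.commute)
qed

definition T1_summand :: "nat \<Rightarrow> nat \<Rightarrow> int poly fract" where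
  "T1_summand m k =
     (- qvar) ^ k * qchoose (qvar\<^sup>2) (m * n) k * qchoose qvar (2 * (m * n) - 2 * k) (n - k)"

lemma T1_conv_sum_T1_summand:
  assumes "m > 0"
  shows "T1 (m * n) ((int m - 1) * int n) qvar = (\<Sum>k\<le>n. T1_summand m k)"
proof -
  have "n \<le> m * n" using assms by simp
  have bottom: "int (m * n) - (int m - 1) * int n - int k = int n - int k" for k
    by (simp add: algebra_simps)
  have "T1 (m * n) ((int m - 1) * int n) qvar = (\<Sum>k\<le>n. (- qvar) ^ k
      * qbinom (qvar\<^sup>2) (int (m * n)) (int k)
      * qbinom qvar (2 * int (m * n) - 2 * int k) (int n - int k))"
    unfolding T1_def bottom
    by (rule sum.mono_neutral_right) (auto simp: qbinom_def intro: order_trans[OF _ \<open>n \<le> m * n\<close>])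
  also have "\<dots> = (\<Sum>k\<le>n. T1_summand m k)"
  proof (rule sum.cong)
    fix k assume k: "k \<in> {..n}"
    hence "k \<le> m * n" using \<open>n \<le> m * n\<close> by (meson atMost_iff order_trans)
    hence "2 * int (m * n) - 2 * int k = int (2 * (m * n) - 2 * k)" by (simp add: of_nat_diff)
    moreover have "int n - int k = int (n - k)" using k by simp
    ultimately show "(- qvar) ^ k * qbinom (qvar\<^sup>2) (int (m * n)) (int k)
        * qbinom qvar (2 * int (m * n) - 2 * int k) (int n - int k) = T1_summand m k"
      by (simp only: T1_summand_def qbinom_conv_qchoose)
  qed simp
  finally show ?thesis .
qed

lemma qvar_power_quotient_cong:
  assumes "n = k + j" "0 < j" "j < k"
  shows "qvar ^ (2 * k) / (1 - qvar ^ (2 * k)) / qvar ^ (k * k)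
    \<cong>\<^bsub>1\<^esub> - 1 / (1 - qvar ^ (2 * j)) / qvar ^ (j * j)"
proof (rule cong_mod_divide)
  have "1 - qvar ^ (2 * k + 2 * j) \<in> \<I> 1"
    by (rule one_minus_qvar_power) (simp only: assms(1) distrib_left[symmetric] dvd_triv_right)
  thus "qvar ^ (2 * k) / (1 - qvar ^ (2 * k)) \<cong>\<^bsub>1\<^esub> - 1 / (1 - qvar ^ (2 * j))"
    using assms by (intro power_quotient_reflect_cong units_one_minus_qvar_power_double) linarith+
  show "qvar ^ (k * k) \<cong>\<^bsub>1\<^esub> qvar ^ (j * j)"
  proof (rule power_cong_mod_period)
    have "k * k + 2 * j * n = j * j + n * n" unfolding assms(1) by (simp add: algebra_simps)
    thus "(k * k) mod n = (j * j) mod n" by (metis mod_mult_self1)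
  qed (intro qvar_intros)+
qed (intro qvar_intros)+

lemma uminus_qvar_power_qchoose_sq_cong:
  assumes "m > 0" "n = k + j" "0 < j" "j < k"
  shows "(- qvar) ^ k * qchoose (qvar\<^sup>2) (m * n) k \<cong>\<^bsub>2\<^esub> (1 - qvar ^ n) *
    (of_nat (2 * m) * parity_factor m * (- 1 / (1 - qvar ^ (2 * j)) / qvar ^ (j * j)))"
proof -
  let ?c = "of_nat (2 * m) * parity_factor m"
  have "qvar ^ (k * k) = qvar ^ k * qvar ^ (k * (k - 1))"
    using assms by (cases k) (simp_all flip: power_add)
  moreover have "qvar ^ (2 * k) = qvar ^ k * qvar ^ k" by (simp only: mult_2 power_add)
  moreover have "(- qvar) ^ k * (-1) ^ k = qvar ^ k" by (simp flip: power_mult_distrib)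
  ultimately have power:
      "(- qvar) ^ k * (-1) ^ k / qvar ^ (k * (k - 1)) = qvar ^ (2 * k) / qvar ^ (k * k)"
    using qvar_neq_0 by (simp only:) simp
  have "(- qvar) ^ k * qchoose (qvar\<^sup>2) (m * n) k \<cong>\<^bsub>2\<^esub> (- qvar) ^ k * ((1 - qvar ^ n) *
      (of_nat (2 * m) * ((-1) ^ k * parity_factor m / qvar ^ (k * (k - 1))) / (1 - qvar ^ (2 * k))))"
    using assms by (intro cong_mod_mult qchoose_sq_cong cong_mod_refl integral_intros
        integral_qvar) auto
  also have "\<dots> = (1 - qvar ^ n) *
      (?c * ((- qvar) ^ k * (-1) ^ k / qvar ^ (k * (k - 1)) / (1 - qvar ^ (2 * k))))"
    by (simp add: mult_ac)
  also have "\<dots> = (1 - qvar ^ n) * (?c * (qvar ^ (2 * k) / (1 - qvar ^ (2 * k)) / qvar ^ (k * k)))"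
    unfolding power by (simp add: mult.commute)
  also have "\<dots> \<cong>\<^bsub>2\<^esub> (1 - qvar ^ n) * (?c * (- 1 / (1 - qvar ^ (2 * j)) / qvar ^ (j * j)))"
    by (intro cong_mod_2_mult one_minus_qvar_power_n cong_mod_mult[OF cong_mod_refl]
          qvar_power_quotient_cong assms integral_intros integral_parity_factor)
  finally show ?thesis .
qed

lemma qchoose_complement_cong:
  assumes "m > 0" "n = k + j" "0 < k"
  shows "qchoose qvar (2 * (m * n) - 2 * k) (n - k) \<cong>\<^bsub>1\<^esub> qchoose qvar (2 * j) j"
proof -
  obtain c where m_eq: "m = Suc c" using assms(1) by (cases m) auto
  have "1 - qvar ^ (2 * c * n) \<in> \<I> 1" by (rule one_minus_qvar_power) simp
  moreover have "order_exceeds qvar j" using assms(2,3) by (intro order_exceeds_qvar) simp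
  ultimately have "qchoose qvar (2 * c * n + j + j) j \<cong>\<^bsub>1\<^esub> qchoose qvar (j + j) j"
    by (rule qchoose_add_period_cong[OF integral_qvar])
  moreover have "2 * (m * n) - 2 * k = 2 * c * n + j + j" "n - k = j"
    unfolding m_eq using assms(2) by (simp_all add: algebra_simps)
  ultimately show ?thesis by (simp only: mult_2)
qed

lemma T1_summand_cong_qlucas_less:
  assumes "m > 0" "0 < j" "2 * j < n"
  shows "T1_summand m (n - j) \<cong>\<^bsub>2\<^esub> 2 * of_nat m * parity_factor m * qlucas_term qvar n j"
proof -
  define k where "k = n - j"
  have k: "n = k + j" "0 < k" "j < k" using assms by (auto simp: k_def)
  let ?c = "of_nat (2 * m) * parity_factor m" and ?C = "qchoose qvar (2 * j) j"
  have c_integral: "?c \<in> \<I> 0" by (intro integral_intros integral_parity_factor)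
  have "1 - qvar ^ (2 * j) \<in> \<U>" using assms by (intro units_one_minus_qvar_power_double) auto
  hence "?c * (- 1 / (1 - qvar ^ (2 * j)) / qvar ^ (j * j)) \<in> \<I> 0"
    by (intro integral_intros integral_parity_factor qvar_intros)
  hence "T1_summand m k \<cong>\<^bsub>2\<^esub>
      (1 - qvar ^ n) * (?c * (- 1 / (1 - qvar ^ (2 * j)) / qvar ^ (j * j)) * ?C)"
    unfolding T1_summand_def
    by (intro cong_mod_2_mult_right one_minus_qvar_power_n uminus_qvar_power_qchoose_sq_cong
          qchoose_complement_cong assms k)
  also have "\<dots> = ?c * ((1 - qvar ^ n) * - (?C / (qvar ^ (j * j) * (1 - qvar ^ (2 * j)))))"
    by (simp add: mult_ac)
  also have "\<dots> \<cong>\<^bsub>2\<^esub> ?c * qlucas_term qvar n j"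
    by (intro cong_mod_mult cong_mod_refl c_integral cong_mod_sym[OF qlucas_term_cong] assms)
  finally show ?thesis by (simp add: k_def)
qed

lemma qvar_half_period_cong:
  assumes "n = 2 * h"
  shows "qvar ^ h \<cong>\<^bsub>1\<^esub> - 1"
proof (rule cong_modI)
  have unit: "1 - qvar ^ h \<in> \<U>"
    using assms n_pos by (intro units_one_minus_qvar_power) (auto dest: dvd_imp_le)
  have "1 - qvar ^ n = (1 - qvar ^ h) * (qvar ^ h - - 1)"
    unfolding assms mult_2 power_add by (simp add: algebra_simps)
  hence "qvar ^ h - - 1 = (1 - qvar ^ n) / (1 - qvar ^ h)"
    using units_imp_neq_0[OF unit] by simp
  also have "\<dots> \<in> \<I> 1" by (intro ideal_pow_divide one_minus_qvar_power_n unit)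
  finally show "qvar ^ h - - 1 \<in> \<I> 1" .
qed (intro integral_intros)

lemma qvar_half_period_power_cong:
  assumes "n = 2 * h"
  shows "(- qvar) ^ h * ((-1) ^ (h - 1) / qvar ^ (h choose 2))
    \<cong>\<^bsub>1\<^esub> (-1) ^ h * qvar ^ (h choose 2) / qvar ^ h"
proof -
  define y t where "y = qvar ^ h" and "t = qvar ^ (h choose 2)"
  have units: "t * y \<in> \<U>" unfolding t_def y_def by (intro units_mult qvar_intros)
  hence "t \<noteq> 0" "y \<noteq> 0" by (auto dest: units_imp_neq_0)
  have "h > 0" using assms n_pos by simp
  hence sign: "(-1) ^ h * (-1) ^ (h - 1) = (- 1 :: int poly fract)"
    by (cases h) (simp_all flip: power_mult_distrib)
  have y_cong: "y \<cong>\<^bsub>1\<^esub> - 1" unfolding y_def by (rule qvar_half_period_cong[OF assms])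
  have "(- qvar) ^ h = (-1) ^ h * y" by (simp add: y_def flip: power_mult_distrib)
  hence "(- qvar) ^ h * ((-1) ^ (h - 1) / t) = - (y ^ 2) / (t * y)"
    using \<open>y \<noteq> 0\<close> sign by (simp add: power2_eq_square mult_ac)
  also have "\<dots> = (- 1) * y ^ 2 / (t * y)" by simp
  also have "\<dots> \<cong>\<^bsub>1\<^esub> (- 1) * (- 1) ^ 2 / (t * y)"
    by (intro cong_mod_divide_right units cong_mod_mult cong_mod_power y_cong cong_mod_refl
          integral_intros)
  also have "\<dots> = (-1) ^ h * (- 1) ^ (h - 1) / (t * y)" unfolding sign by simp
  also have "\<dots> \<cong>\<^bsub>1\<^esub> (-1) ^ h * y ^ (h - 1) / (t * y)"
    by (intro cong_mod_divide_right units cong_mod_mult cong_mod_power cong_mod_sym[OF y_cong]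
          cong_mod_refl integral_intros)
  also have "y ^ (h - 1) = t * t"
    unfolding y_def t_def power_mult[symmetric] double_choose_2[symmetric]
    by (simp add: mult_2 power_add)
  also have "(-1) ^ h * (t * t) / (t * y) = (-1) ^ h * t / y" using \<open>t \<noteq> 0\<close> by simp
  finally show ?thesis unfolding t_def y_def .
qed

lemma T1_summand_in_ideal_pow_2:
  assumes "m > 0" "0 < k" "2 * k < n"
  shows "T1_summand m k \<in> \<I> 2"
proof -
  have "n \<le> m * n" using assms(1) by simp
  have "qchoose (qvar\<^sup>2) (m * n) k \<in> \<I> 1"
  proof (rule qchoose_in_ideal_pow)
    show "1 - (qvar\<^sup>2) ^ (m * n) \<in> \<I> 1"
      unfolding qvar_sq_power by (rule one_minus_qvar_power) simp
  qed (use assms in \<open>auto intro!: order_exceeds_qvar_sq integral_power integral_qvar\<close>)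
  moreover have "qchoose qvar (2 * (m * n) - 2 * k) (n - k) \<in> \<I> 1"
  proof (rule qchoose_in_ideal_pow)
    show "1 - qvar ^ (2 * (m * n) - n) \<in> \<I> 1"
      by (rule one_minus_qvar_power) (simp add: dvd_diff_nat)
    show "2 * (m * n) - n \<le> 2 * (m * n) - 2 * k" "2 * (m * n) - 2 * k < 2 * (m * n) - n + (n - k)"
      using assms \<open>n \<le> m * n\<close> by linarith+
  qed (use assms in \<open>auto intro!: order_exceeds_qvar integral_qvar\<close>)
  ultimately show ?thesis unfolding T1_summand_def
    by (intro ideal_pow_2_mult ideal_pow_mult_left integral_intros integral_qvar)
qed

lemma qchoose_odd_multiple_half_cong:
  assumes "m > 0" "n = 2 * h"
  shows "qchoose qvar ((2 * m - 1) * n) h \<cong>\<^bsub>2\<^esub>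
    (1 - qvar ^ n) * (of_nat (2 * m - 1) * ((-1) ^ (h - 1) / qvar ^ (h choose 2)) / (1 - qvar ^ h))"
proof (rule qchoose_absorption_cong)
  let ?N = "(2 * m - 1) * n"
  show "0 < h" using assms(2) n_pos by simp
  have "h < n" using assms(2) n_pos by simp
  thus "1 - qvar ^ h \<in> \<U>" using \<open>0 < h\<close> by (intro order_exceedsD[OF order_exceeds_qvar]) auto
  have "1 * n \<le> ?N" by (rule mult_le_mono1) (use assms(1) in linarith)
  thus "h \<le> ?N" using \<open>h < n\<close> by linarith
  have "1 - qvar ^ ?N \<in> \<I> 1" by (rule one_minus_qvar_power) simp
  thus "qchoose qvar (?N - 1) (h - 1) \<cong>\<^bsub>1\<^esub> (-1) ^ (h - 1) / qvar ^ (h choose 2)"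
    using qchoose_pred_cong[of qvar ?N "h - 1"] \<open>0 < h\<close> \<open>h < n\<close> \<open>h \<le> ?N\<close>
    by (simp add: units_qvar order_exceeds_qvar)
  show "qvar ^ ?N = (qvar ^ n) ^ (2 * m - 1)" by (simp add: mult.commute flip: power_mult)
qed (rule one_minus_qvar_power_n)

lemma T1_summand_half:
  assumes "n = 2 * h"
  shows "T1_summand m h
    = qchoose qvar ((2 * m - 1) * n) h * ((- qvar) ^ h * qchoose (qvar\<^sup>2) (m * n) h)"
proof -
  have "2 * (m * n) - 2 * h = (2 * m - 1) * n" "n - h = h"
    unfolding assms by (simp_all add: algebra_simps)
  thus ?thesis by (simp add: T1_summand_def)
qed

lemma T1_summand_cong_qlucas_half:
  assumes "m > 0" and n_eq: "n = 2 * h"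
  shows "T1_summand m h \<cong>\<^bsub>2\<^esub> 2 * of_nat m * parity_factor m * qlucas_term qvar n h"
proof -
  have "even n" "0 < h" "h < n" using n_eq n_pos by auto
  hence unit: "1 - qvar ^ h \<in> \<U>" by (intro order_exceedsD[OF order_exceeds_qvar]) auto
  define X where "X = (-1) ^ (h - 1) / qvar ^ (h choose 2)"
  let ?c = "of_nat (2 * m - 1) * of_nat (2 * m) :: int poly fract"
  have "T1_summand m h
      = qchoose qvar ((2 * m - 1) * n) h * ((- qvar) ^ h * qchoose (qvar\<^sup>2) (m * n) h)"
    by (rule T1_summand_half[OF n_eq])
  also have "\<dots> \<cong>\<^bsub>2\<^esub>
      (1 - qvar ^ n) * (of_nat (2 * m - 1) * X / (1 - qvar ^ h) * ((- qvar) ^ h * of_nat (2 * m)))"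
  proof (rule cong_mod_2_mult_right)
    have "qchoose (qvar\<^sup>2) (2 * m * h) h \<cong>\<^bsub>1\<^esub> of_nat (2 * m)"
      using assms(1) by (intro qchoose_multiple_cong_of_nat has_order_qvar_sq_even n_eq) simp
    moreover have "2 * m * h = m * n" by (simp add: n_eq)
    ultimately show "(- qvar) ^ h * qchoose (qvar\<^sup>2) (m * n) h \<cong>\<^bsub>1\<^esub> (- qvar) ^ h * of_nat (2 * m)"
      by (intro cong_mod_mult cong_mod_refl integral_intros integral_qvar) (simp only:)
    show "of_nat (2 * m - 1) * X / (1 - qvar ^ h) \<in> \<I> 0"
      unfolding X_def by (intro integral_intros unit qvar_intros)
    show "qchoose qvar ((2 * m - 1) * n) h \<cong>\<^bsub>2\<^esub>
        (1 - qvar ^ n) * (of_nat (2 * m - 1) * X / (1 - qvar ^ h))"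
      unfolding X_def by (rule qchoose_odd_multiple_half_cong[OF assms])
  qed (rule one_minus_qvar_power_n)
  also have "\<dots> = (1 - qvar ^ n) * (?c * ((- qvar) ^ h * X / (1 - qvar ^ h)))"
    by (simp add: mult_ac)
  also have "\<dots> \<cong>\<^bsub>2\<^esub>
      (1 - qvar ^ n) * (?c * ((-1) ^ h * qvar ^ (h choose 2) / qvar ^ h / (1 - qvar ^ h)))"
    unfolding X_def
    by (intro cong_mod_2_mult cong_mod_mult[OF cong_mod_refl] cong_mod_divide_right
          qvar_half_period_power_cong n_eq unit one_minus_qvar_power_n integral_of_nat integral_mult)
  also have "\<dots> = ?c * qlucas_term qvar n h"
    unfolding n_eq qlucas_term_half[OF infinite_order_qvar] by (rule mult.left_commute)
  also have "?c = 2 * of_nat m * parity_factor m"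
    using assms(1) \<open>even n\<close> by (simp add: parity_factor_even of_nat_diff)
  finally show ?thesis .
qed

lemma T1_summand_cong_qlucas:
  assumes "m > 0" "0 < j" "j < n"
  shows "T1_summand m (n - j) \<cong>\<^bsub>2\<^esub> 2 * of_nat m * parity_factor m * qlucas_term qvar n j"
proof -
  consider "2 * j < n" | "n = 2 * j" | "n < 2 * j" by linarith
  thus ?thesis
  proof cases
    case 1
    show ?thesis by (rule T1_summand_cong_qlucas_less[OF assms(1,2) 1])
  next
    case 2
    hence "n - j = j" by simp
    thus ?thesis using T1_summand_cong_qlucas_half[OF assms(1) 2] by (simp only:)
  next
    case 3
    have "T1_summand m (n - j) \<in> \<I> 2" by (rule T1_summand_in_ideal_pow_2) (use assms 3 in auto)
    moreover have "qlucas_term qvar n j = 0"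
      unfolding qlucas_term_def using 3 assms by (simp add: qchoose_eq_0)
    ultimately show ?thesis by (simp add: cong_mod_0_iff)
  qed
qed

lemma sum_T1_summand_cong:
  assumes "m > 0"
  shows "(\<Sum>k=1..<n. T1_summand m k) \<cong>\<^bsub>2\<^esub> 2 * of_nat m * parity_factor m * (Bn n qvar - 1)"
proof -
  have "(\<Sum>k=1..<n. T1_summand m k) = (\<Sum>j=1..<n. T1_summand m (n - j))"
    by (rule sum.reindex_bij_witness[of _ "\<lambda>j. n - j" "\<lambda>k. n - k"]) auto
  also have "\<dots> \<cong>\<^bsub>2\<^esub> (\<Sum>j=1..<n. 2 * of_nat m * parity_factor m * qlucas_term qvar n j)"
    using assms by (intro cong_mod_sum T1_summand_cong_qlucas) auto
  also have "\<dots> = 2 * of_nat m * parity_factor m * (Bn n qvar - 1)"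
    unfolding Bn_conv_qlucas_sum[OF infinite_order_qvar qvar_neq_0 n_pos]
    by (simp add: sum_distrib_left)
  finally show ?thesis .
qed

lemma T1_summand_0_cong:
  assumes "m > 0"
  shows "T1_summand m 0 \<cong>\<^bsub>2\<^esub>
    2 * of_nat m - of_nat n * of_nat m * (2 * of_nat m - 1) * (1 - qvar ^ n)"
proof -
  have "qchoose qvar ((2 * m) * n) n \<cong>\<^bsub>2\<^esub>
      of_nat (2 * m) - of_nat n * of_nat (2 * m choose 2) * (1 - qvar ^ n)"
    using assms by (intro qchoose_multiple_cong has_order_qvar) simp
  moreover have "2 * m choose 2 = m * (2 * m - 1)" by (simp add: choose_two)
  ultimately show ?thesis using assms by (simp add: T1_summand_def of_nat_diff mult.assoc)
qed

lemma T1_summand_n_cong: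
  assumes "m > 0"
  shows "T1_summand m n \<cong>\<^bsub>2\<^esub>
    parity_factor m * (of_nat m * qvar ^ n - of_nat n * of_nat m * (of_nat m - 1) * (1 - qvar ^ n))"
proof -
  let ?Y = "of_nat n * of_nat m * (of_nat m - 1) :: int poly fract"
  have "(- qvar) ^ n * (-1) ^ n = qvar ^ n" by (simp flip: power_mult_distrib)
  have "T1_summand m n = (- qvar) ^ n * qchoose (qvar\<^sup>2) (m * n) n"
    by (simp add: T1_summand_def)
  also have "\<dots> \<cong>\<^bsub>2\<^esub> (- qvar) ^ n * ((-1) ^ n * parity_factor m * (of_nat m - ?Y * (1 - qvar ^ n)))"
    by (intro cong_mod_mult cong_mod_refl qchoose_sq_n_cong assms integral_intros integral_qvar)
  also have "\<dots> = qvar ^ n * (parity_factor m * (of_nat m - ?Y * (1 - qvar ^ n)))"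
    by (simp only: \<open>(- qvar) ^ n * (-1) ^ n = qvar ^ n\<close> flip: mult.assoc)
  also have "\<dots> \<cong>\<^bsub>2\<^esub> parity_factor m * (of_nat m * qvar ^ n - ?Y * (1 - qvar ^ n))"
    by (rule cong_mod_squareI[OF one_minus_qvar_power_n, of "parity_factor m * ?Y"])
       (intro integral_intros integral_parity_factor integral_qvar, simp add: algebra_simps)+
  finally show ?thesis .
qed

lemma T1_cong:
  assumes "m > 0"
  shows "T1 (m * n) ((int m - 1) * int n) qvar \<cong>\<^bsub>2\<^esub>
    2 * of_nat m - of_nat n * of_nat m * (2 * of_nat m - 1) * (1 - qvar ^ n)
      + parity_factor m * (of_nat m * qvar ^ n - of_nat n * of_nat m * (of_nat m - 1) * (1 - qvar ^ n)
           + 2 * of_nat m * (Bn n qvar - 1))"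
proof -
  have "{..n} = insert 0 (insert n {1..<n})" using n_pos by auto
  hence "T1 (m * n) ((int m - 1) * int n) qvar =
      T1_summand m 0 + (T1_summand m n + (\<Sum>k=1..<n. T1_summand m k))"
    unfolding T1_conv_sum_T1_summand[OF assms] using n_pos by simp
  also have "\<dots> \<cong>\<^bsub>2\<^esub> 2 * of_nat m - of_nat n * of_nat m * (2 * of_nat m - 1) * (1 - qvar ^ n)
      + (parity_factor m * (of_nat m * qvar ^ n - of_nat n * of_nat m * (of_nat m - 1) * (1 - qvar ^ n))
        + 2 * of_nat m * parity_factor m * (Bn n qvar - 1))"
    by (intro cong_mod_add T1_summand_0_cong T1_summand_n_cong sum_T1_summand_cong assms)
  finally show ?thesis by (simp only: distrib_left mult_ac)
qed

end

theorem theorem1p3: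
  fixes m n :: nat
  assumes "m > 0" and "n > 0"
  shows "ratfun_cong
    (T1 (m * n) ((int m - 1) * int n) qvar)
    (2 * of_nat m - of_nat n * of_nat m * (2 * of_nat m - 1) * (1 - qvar ^ n)
      + (-1) ^ n * ((1 + (-1) ^ n) * (of_nat m - 1) + 1)
        * (of_nat m * qvar ^ n - of_nat n * of_nat m * (of_nat m - 1) * (1 - qvar ^ n)
           + 2 * of_nat m * (Bn n qvar - 1)))
    ((cyclotomic n)\<^sup>2)"
proof -
  interpret cyclotomic_localization n by unfold_locales (rule assms(2))
  show ?thesis using T1_cong[OF assms(1)] unfolding parity_factor_def by (rule ratfun_congI)
qed

end
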